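(* Let $\mathcal{G}:\mathbb{R}^n\to\mathbb{R}^n$ be analytic with Helmholtz decomposition $\mathcal{G}=\nabla J+\operatorname{rot}K$ (see context), and suppose the following hold: (i) there exists $\kappa_J>0$ such that $\langle\nabla J(x_1)-\nabla J(x_2),x_1-x_2\rangle\ge\kappa_J|x_1-x_2|^2$ for all $x_1,x_2\in\mathbb{R}^n$, and $\langle\operatorname{rot}K(x_1)-\operatorname{rot}K(x_2),x_1-x_2\rangle\ge0$ for all $x_1,x_2\in\mathbb{R}^n$; (ii) there exist $\ell_J,\ell_K>0$ such that $|\nabla J(x_1)-\nabla J(x_2)|\le\ell_J|x_1-x_2|$ and $|\operatorname{rot}K(x_1)-\operatorname{rot}K(x_2)|\le\ell_K|x_1-x_2|$ for all $x_1,x_2\in\mathbb{R}^n$. Let $0<T_0<T$ and $\eta\in(0,1)$, and suppose that $\underline{T}<T\le\overline{T}$, where $$\underline{T}^2:=T_0^2+\frac{4\eta^2}{\kappa_J},\quad \underline{T}>0,\qquad \overline{T}:=\frac{2\min\{3(1-\eta),\,\kappa_J\eta\}}{\ell_K}.$$ Let $\mathcal{H}=(C,f,D,g)$ be the restarting hybrid dynamical system and $\mathcal{A}=\{x^\star\}\times\{0\}\times[T_0,T]$ the set defined in the context, where $x^\star$ is the unique point with $\mathcal{G}(x^\star)=0$. Then $\mathcal{A}$ is uniformly globally exponentially stable for $\mathcal{H}$. Moreover, there exists $\rho>0$ such that, for each compact set $K_0\subset C\cup D$, there exist $M_J,M_{\mathcal{G}}>0$ for which each solution $\chi=(q,p,\tau)$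 of $\mathcal{H}$ with $\chi(0,0)\in K_0$ satisfies $$\tilde J(q(t,j))\le\frac{M_J T^2e^{-\rho j}}{\tau^2(t,j)},\qquad |\mathcal{G}(q(t,j))|^2\le\frac{M_{\mathcal{G}}T^2e^{-\rho j}}{\tau^2(t,j)}\qquad\text{for all }(t,j)\in\operatorname{dom}\chi,$$ where $\tilde J(q):=J(q)-J(x^\star)$ for all $q\in\mathbb{R}^n$.
   Context: $|\cdot|$ is the Euclidean norm, $\langle\cdot,\cdot\rangle$ the Euclidean inner product, and $|z|_S:=\min_{s\in S}|z-s|$ for a closed set $S$. Helmholtz decomposition: for $K:\mathbb{R}^n\to\mathbb{R}^{n\times n}$, $\operatorname{rot}K:\mathbb{R}^n\to\mathbb{R}^n$ is given by $(\operatorname{rot}K(x))_i=\sum_{j=1}^n\frac{\partial K_{ij}}{\partial x_j}(x)$. For analytic $\mathcal{G}$ there exist $P:\mathbb{R}^n\to\mathbb{R}^{n\times n}$, $J:\mathbb{R}^n\to\mathbb{R}$ and $K:\mathbb{R}^n\to\mathbb{R}^{n\times n}$ with $\mathcal{G}(x)=\nabla J(x)+\operatorname{rot}K(x)$ for all $x\in\mathbb{R}^n$, where $J(x)=\sum_{i=1}^nP_{ii}(x)$, $K(x)=P(x)-P(x)^{\top}$ (with $^{\top}$ denoting the matrix transpose), $\operatorname{div}(\operatorname{rot}K(x))=0$ and the matrix with entries $\frac{\partial(\nabla J)_i}{\partial x_j}-\frac{\partial(\nabla J)_j}{\partial x_i}$ vanishes identically. $J$ and $K$ in the claim refer to this decomposition.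 The hybrid system $\mathcal{H}=(C,f,D,g)$ has state $\chi=(q,p,\tau)\in\mathbb{R}^n\times\mathbb{R}^n\times\mathbb{R}_{\ge0}$, with dynamics $\dot\chi=f(\chi)$ for $\chi\in C$ and $\chi^+=g(\chi)$ for $\chi\in D$, where $$f(\chi)=\begin{pmatrix}p\\-\frac{3}{\tau}p-\mathcal{G}(q)\\\eta\end{pmatrix},\qquad g(\chi)=\begin{pmatrix}q\\0\\ T_0\end{pmatrix},$$ $$C=\{(q,p,\tau):q\in\mathbb{R}^n,\ p\in\mathbb{R}^n,\ \tau\in[T_0,T]\},\qquad D=\{(q,p,\tau):q\in\mathbb{R}^n,\ p\in\mathbb{R}^n,\ \tau=T\}.$$ Solutions are understood in the standard sense of hybrid dynamical systems (Goebel–Sanfelice–Teel): they are hybrid arcs $(t,j)\mapsto\chi(t,j)$ parameterized by continuous time $t\in\mathbb{R}_{\ge0}$ and discrete time $j\in\mathbb{Z}_{\ge0}$ on hybrid time domains $\operatorname{dom}\chi$, flowing in $C$ according to $f$ and jumping from $D$ according to $g$. Uniform global exponential stability (UGES): a compact set $\mathcal{A}$ is UGES for $\mathcal{H}$ if there exist $c_1,c_2>0$ such that $|\chi(t,j)|_{\mathcal{A}}\le c_1|\chi(0,0)|_{\mathcal{A}}e^{-c_2(t+j)}$ for each solution $\chi$ of $\mathcal{H}$ and all $(t,j)\in\operatorname{dom}\chi$. *)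

theory Defs
  imports "HOL-Analysis.Analysis"
begin

definition partial_deriv :: "'n::finite \<Rightarrow> (real^'n \<Rightarrow> real) \<Rightarrow> real^'n \<Rightarrow> real" where
  "partial_deriv j h x = deriv (\<lambda>s. h (x + s *\<^sub>R axis j 1)) 0"

definition grad :: "(real^'n::finite \<Rightarrow> real) \<Rightarrow> real^'n \<Rightarrow> real^'n" where
  "grad h x = (\<chi> i. partial_deriv i h x)"

definition rot :: "(real^'n::finite \<Rightarrow> real^'n^'n) \<Rightarrow> real^'n \<Rightarrow> real^'n" where
  "rot K x = (\<chi> i. \<Sum>j\<in>UNIV. partial_deriv j (\<lambda>y. K y $ i $ j) x)"

definition divergence :: "(real^'n::finite \<Rightarrow> real^'n) \<Rightarrow> real^'n \<Rightarrow> real" where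
  "divergence v x = (\<Sum>i\<in>UNIV. partial_deriv i (\<lambda>y. v y $ i) x)"

(* Local expansion in a multivariate power series; the multi-indices are the functions from the
   finite index type to nat, and the sum is unconditional. *)
definition real_analytic_on ::
    "(real^'n::finite \<Rightarrow> 'b::real_normed_vector) \<Rightarrow> (real^'n) set \<Rightarrow> bool" where
  "real_analytic_on h S \<longleftrightarrow>
     (\<forall>x0\<in>S. \<exists>r>0. \<exists>a :: ('n \<Rightarrow> nat) \<Rightarrow> 'b. \<forall>x\<in>ball x0 r.
        ((\<lambda>\<alpha>. (\<Prod>i\<in>UNIV. (x $ i - x0 $ i) ^ \<alpha> i) *\<^sub>R a \<alpha>) has_sum h x) UNIV)"

(* The differentiability requirements only give meaning to grad J, rot K, the divergence
   of rot K and the partial derivatives of grad J; without them deriv would be unspecified. *)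
definition helmholtz_decomposition ::
    "(real^'n::finite \<Rightarrow> real^'n) \<Rightarrow> (real^'n \<Rightarrow> real^'n^'n) \<Rightarrow> (real^'n \<Rightarrow> real)
      \<Rightarrow> (real^'n \<Rightarrow> real^'n^'n) \<Rightarrow> bool" where
  "helmholtz_decomposition \<G> P J K \<longleftrightarrow>
     (\<forall>x. J x = trace (P x)) \<and>
     (\<forall>x. K x = P x - transpose (P x)) \<and>
     J differentiable_on UNIV \<and> K differentiable_on UNIV \<and>
     grad J differentiable_on UNIV \<and> rot K differentiable_on UNIV \<and>
     (\<forall>x. \<G> x = grad J x + rot K x) \<and>
     (\<forall>x. divergence (rot K) x = 0) \<and>
     (\<forall>x i j. partial_deriv j (\<lambda>y. grad J y $ i) x - partial_deriv i (\<lambda>y. grad J y $ j) x = 0)"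

record 'a hybrid_system =
  flow_set :: "'a set"
  flow_map :: "'a \<Rightarrow> 'a"
  jump_set :: "'a set"
  jump_map :: "'a \<Rightarrow> 'a"

definition compact_hybrid_time_domain :: "(real \<times> nat) set \<Rightarrow> bool" where
  "compact_hybrid_time_domain E \<longleftrightarrow>
     (\<exists>N s. s 0 = 0 \<and> (\<forall>j<N. s j \<le> s (Suc j)) \<and> E = (\<Union>j<N. {s j..s (Suc j)} \<times> {j}))"

definition hybrid_time_domain :: "(real \<times> nat) set \<Rightarrow> bool" where
  "hybrid_time_domain E \<longleftrightarrow>
     E \<subseteq> {0..} \<times> UNIV \<and>
     (\<forall>(t, j)\<in>E. compact_hybrid_time_domain (E \<inter> ({0..t} \<times> {..j})))"

definition flow_interval :: "(real \<times> nat) set \<Rightarrow> nat \<Rightarrow> real set" where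
  "flow_interval E j = {t. (t, j) \<in> E}"

(* The finite families of nonoverlapping compact subintervals of S are the divisions of their union;
   Inf k and Sup k are the endpoints of the interval k. *)
definition absolutely_cont_on :: "(real \<Rightarrow> 'a::real_normed_vector) \<Rightarrow> real set \<Rightarrow> bool" where
  "absolutely_cont_on h S \<longleftrightarrow>
     (\<forall>\<epsilon>>0. \<exists>\<delta>>0. \<forall>d. d division_of \<Union>d \<and> \<Union>d \<subseteq> S \<and> (\<Sum>k\<in>d. Sup k - Inf k) < \<delta>
        \<longrightarrow> (\<Sum>k\<in>d. norm (h (Sup k) - h (Inf k))) < \<epsilon>)"

definition locally_absolutely_cont_on :: "(real \<Rightarrow> 'a::real_normed_vector) \<Rightarrow> real set \<Rightarrow> bool"
  where
  "locally_absolutely_cont_on h I \<longleftrightarrow> (\<forall>a b. {a..b} \<subseteq> I \<longrightarrow> absolutely_cont_on h {a..b})"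

(* A hybrid arc is represented by its domain E together with a function whose values outside E are
   irrelevant. *)
definition hybrid_arc ::
    "(real \<times> nat) set \<Rightarrow> (real \<Rightarrow> nat \<Rightarrow> 'a::real_normed_vector) \<Rightarrow> bool" where
  "hybrid_arc E \<phi> \<longleftrightarrow>
     hybrid_time_domain E \<and>
     (\<forall>j. locally_absolutely_cont_on (\<lambda>t. \<phi> t j) (flow_interval E j))"

definition hybrid_solution ::
    "'a::real_normed_vector hybrid_system \<Rightarrow> (real \<times> nat) set \<Rightarrow> (real \<Rightarrow> nat \<Rightarrow> 'a) \<Rightarrow> bool"
  where
  "hybrid_solution H E \<phi> \<longleftrightarrow>
     hybrid_arc E \<phi> \<and> (0, 0) \<in> E \<and>
     \<phi> 0 0 \<in> closure (flow_set H) \<union> jump_set H \<and>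
     (\<forall>j. interior (flow_interval E j) \<noteq> {} \<longrightarrow>
        (\<forall>t\<in>interior (flow_interval E j). \<phi> t j \<in> flow_set H) \<and>
        (AE t in lebesgue. t \<in> flow_interval E j \<longrightarrow>
           ((\<lambda>s. \<phi> s j) has_vector_derivative flow_map H (\<phi> t j))
             (at t within flow_interval E j))) \<and>
     (\<forall>t j. (t, j) \<in> E \<and> (t, Suc j) \<in> E \<longrightarrow>
        \<phi> t j \<in> jump_set H \<and> \<phi> t (Suc j) = jump_map H (\<phi> t j))"

definition UGES :: "'a::real_normed_vector hybrid_system \<Rightarrow> 'a set \<Rightarrow> bool" where
  "UGES H A \<longleftrightarrow>
     compact A \<and>
     (\<exists>c1>0. \<exists>c2>0. \<forall>E \<phi>. hybrid_solution H E \<phi> \<longrightarrow>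
        (\<forall>(t, j)\<in>E. infdist (\<phi> t j) A \<le> c1 * infdist (\<phi> 0 0) A * exp (- c2 * (t + real j))))"

(* The norm on the product type is the Euclidean norm of the stacked vector (q, p, \<tau>). *)
type_synonym 'n state = "(real^'n) \<times> (real^'n) \<times> real"

definition restarting_system ::
    "(real^'n::finite \<Rightarrow> real^'n) \<Rightarrow> real \<Rightarrow> real \<Rightarrow> real \<Rightarrow> 'n state hybrid_system" where
  "restarting_system \<G> \<eta> T0 T =
     \<lparr> flow_set = {(q, p, \<tau>). \<tau> \<in> {T0..T}},
       flow_map = (\<lambda>(q, p, \<tau>). (p, - (3 / \<tau>) *\<^sub>R p - \<G> q, \<eta>)),
       jump_set = {(q, p, \<tau>). \<tau> = T},
       jump_map = (\<lambda>(q, p, \<tau>). (q, 0, T0)) \<rparr>"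

end

theory Submission
  imports Defs
begin

text \<open>Let \<open>s\<close> be the zero of \<open>\<G>\<close>. In general \<open>grad J s \<noteq> 0\<close>, so \<open>J q - J s\<close> is not positive definite; replacing
  \<open>J\<close> by \<open>U q = J q - J s - grad J s \<bullet> (q - s)\<close> and \<open>rot K\<close> by \<open>rot K - rot K s\<close> keeps the sum of the two
  fields and makes both vanish at \<open>s\<close>. With \<open>e = q - s\<close>, the function
  \<open>V = |2 \<eta> e + \<tau> p|^2 / 2 + 3 \<eta> (1 - \<eta>) |e|^2 + \<tau>^2 U q\<close> does not increase along flows, because the upper
  bound on \<open>T\<close> lets the damping and the strong convexity absorb the rotational term, and a jump
  multiplies it by a constant factor below 1, because of the lower bound on \<open>T\<close>. Jumps are at most
  \<open>(T - T0) / \<eta>\<close> apart, which gives exponential decay in \<open>t + j\<close>. The estimates on \<open>J\<close> and \<open>\<G>\<close> follow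
  from stability, as the linear term \<open>grad J s \<bullet> (q - s)\<close> only lowers the rate.\<close>

section \<open>Absolutely continuous functions\<close>

text \<open>One interval is already a division of itself, so the condition on finite families
  contains uniform continuity.\<close>

lemma absolutely_cont_on_imp_continuous_on:
  fixes h :: "real \<Rightarrow> 'a::real_normed_vector"
  assumes "absolutely_cont_on h {a..b}"
  shows "continuous_on {a..b} h"
  unfolding continuous_on_iff
proof (intro ballI allI impI)
  fix x e :: real
  assume x: "x \<in> {a..b}" and "e > 0"
  then obtain \<delta> where "\<delta> > 0" and
    \<delta>: "\<And>d. d division_of \<Union>d \<Longrightarrow> \<Union>d \<subseteq> {a..b} \<Longrightarrow> (\<Sum>k\<in>d. Sup k - Inf k) < \<delta>
          \<Longrightarrow> (\<Sum>k\<in>d. norm (h (Sup k) - h (Inf k))) < e"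
    using assms unfolding absolutely_cont_on_def by meson
  have *: "norm (h v - h u) < e" if "u \<le> v" "u \<in> {a..b}" "v \<in> {a..b}" "v - u < \<delta>" for u v
    using \<delta>[of "{{u..v}}"] division_of_self[of u v] that by (auto simp: cbox_interval)
  show "\<exists>d>0. \<forall>y\<in>{a..b}. dist y x < d \<longrightarrow> dist (h y) (h x) < e"
  proof (intro exI[of _ \<delta>] conjI ballI impI)
    fix y assume "y \<in> {a..b}" "dist y x < \<delta>"
    then show "dist (h y) (h x) < e"
      using *[of x y] *[of y x] x
      by (cases "x \<le> y") (auto simp: dist_norm norm_minus_commute)
  qed fact
qed

text \<open>The intervals have their lengths as Lebesgue measures, and two of them meet in a convex
  set with empty interior, hence in a null set. So the lengths add up to the measure of the
  union.\<close>

lemma tagged_partial_division_of_sum_length_le: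
  fixes p :: "(real \<times> real set) set"
  assumes p: "p tagged_partial_division_of {a..b}" and U: "U \<in> lmeasurable" "\<Union>(snd ` p) \<subseteq> U"
  shows "(\<Sum>k\<in>snd ` p. Sup k - Inf k) \<le> measure lebesgue U"
proof -
  let ?d = "snd ` p"
  have d: "?d division_of \<Union>?d"
    using partial_division_of_tagged_division[OF p] .
  have cb: "\<exists>u v. k = {u..v} \<and> u \<le> v" if "k \<in> ?d" for k
    using division_ofD(3,4)[OF d that] by (metis atLeastatMost_empty_iff2 box_real(2))
  have "(\<Sum>k\<in>?d. Sup k - Inf k) = (\<Sum>k\<in>?d. measure lebesgue k)"
    using cb by (intro sum.cong) fastforce+
  also have "\<dots> = measure lebesgue (\<Union>?d)"
  proof (rule measure_negligible_finite_Union[symmetric])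
    show "finite ?d" using d by blast
    show "S \<in> lmeasurable" if "S \<in> ?d" for S
      using cb[OF that] by auto
    show "pairwise (\<lambda>S T. negligible (S \<inter> T)) ?d"
    proof (rule pairwiseI)
      fix k l assume kl: "k \<in> ?d" "l \<in> ?d" "k \<noteq> l"
      then have *: "interior k \<inter> interior l = {}"
        using division_ofD(5)[OF d] by blast
      have "convex k" "convex l" using cb[OF kl(1)] cb[OF kl(2)] by auto
      then have "negligible (k \<inter> l) \<longleftrightarrow> interior (k \<inter> l) = {}"
        using negligible_convex_interior convex_Int by blast
      then show "negligible (k \<inter> l)" using * by simp
    qed
  qed
  also have "\<dots> \<le> measure lebesgue U"
    using U d cb by (intro measure_mono_fmeasurable) (auto intro!: fmeasurableD fmeasurable.finite_Union)
  finally show ?thesis .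
qed

text \<open>A gauge argument that admits an arbitrary null set \<open>N\<close>. Intervals tagged
  outside \<open>N\<close> are controlled by differentiability. The gauge keeps those tagged in
  \<open>N\<close> inside an open set of measure below \<open>\<delta>\<close>, so absolute
  continuity bounds the increments of \<open>h\<close> over them.\<close>

theorem absolutely_cont_on_has_integral:
  fixes h :: "real \<Rightarrow> 'a::real_normed_vector"
  assumes ac: "absolutely_cont_on h {a..b}" and "a \<le> b" and N: "negligible N"
    and deriv: "\<And>x. x \<in> {a..b} - N \<Longrightarrow> (h has_vector_derivative h' x) (at x within {a..b})"
  shows "(h' has_integral h b - h a) {a..b}"
proof -
  \<comment> \<open>With value 0 on \<open>N\<close>, \<open>g\<close> contributes nothing to
    Riemann sums at tags in \<open>N\<close>; a change on a null set recovers \<open>h'\<close> at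
    the end.\<close>
  define g where "g x = (if x \<in> N then 0 else h' x)" for x
  have "(g has_integral h b - h a) {a..b}"
    unfolding has_integral_real
  proof (intro allI impI)
    fix e :: real assume "e > 0"
    \<comment> \<open>The error \<open>e\<close> is shared equally between the two kinds of tags;
      \<open>+ 1\<close> avoids a zero denominator when \<open>a = b\<close>.\<close>
    define c where "c = e / (2 * (b - a + 1))"
    have "c > 0" and c: "c * (b - a) < e / 2"
      using \<open>e > 0\<close> \<open>a \<le> b\<close> by (auto simp: c_def field_simps)
    from ac \<open>e > 0\<close> obtain \<delta> where "\<delta> > 0" and
      \<delta>: "\<And>d. d division_of \<Union>d \<Longrightarrow> \<Union>d \<subseteq> {a..b} \<Longrightarrow> (\<Sum>k\<in>d. Sup k - Inf k) < \<delta>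
            \<Longrightarrow> (\<Sum>k\<in>d. norm (h (Sup k) - h (Inf k))) < e / 2"
      unfolding absolutely_cont_on_def by (meson half_gt_zero)
    obtain U where U: "open U" "N \<subseteq> U" "(U - N) \<in> lmeasurable" "emeasure lebesgue (U - N) < ennreal \<delta>"
      using sets_lebesgue_outer_open[of N \<delta>] N \<open>\<delta> > 0\<close> negligible_imp_sets by blast
    have UN: "U = (U - N) \<union> N" using U by auto
    have Um: "U \<in> lmeasurable"
      using U(3) N UN by (metis fmeasurable.Un negligible_imp_measurable)
    have "measure lebesgue U = measure lebesgue (U - N)"
      using N by (intro measure_negligible_symdiff[symmetric])
        (auto intro: fmeasurableD Um U negligible_subset)
    also have "\<dots> < \<delta>"
      using U(3,4) \<open>\<delta> > 0\<close> by (simp add: emeasure_eq_measure2 ennreal_less_iff)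
    finally have U\<delta>: "measure lebesgue U < \<delta>" .
    have "\<forall>x. \<exists>d>0. (x \<in> N \<longrightarrow> ball x d \<subseteq> U) \<and> (x \<in> {a..b} - N \<longrightarrow>
         (\<forall>y\<in>{a..b}. norm (y-x) < d \<longrightarrow> norm (h y - h x - (y-x) *\<^sub>R g x) \<le> c * norm (y-x)))"
    proof
      fix x
      show "\<exists>d>0. (x \<in> N \<longrightarrow> ball x d \<subseteq> U) \<and> (x \<in> {a..b} - N \<longrightarrow>
         (\<forall>y\<in>{a..b}. norm (y-x) < d \<longrightarrow> norm (h y - h x - (y-x) *\<^sub>R g x) \<le> c * norm (y-x)))"
      proof (cases "x \<in> N")
        case True
        then show ?thesis using U openE[of U x] by blast
      next
        case False
        show ?thesis
        proof (cases "x \<in> {a..b}")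
          case True
          then show ?thesis
            using deriv[of x] False \<open>c > 0\<close>
            unfolding has_vector_derivative_def has_derivative_within_alt g_def by auto
        qed (use False in \<open>auto intro: exI[of _ 1]\<close>)
      qed
    qed
    then obtain d where d: "\<And>x. 0 < d x" "\<And>x. x \<in> N \<Longrightarrow> ball x (d x) \<subseteq> U"
      "\<And>x y. \<lbrakk>x \<in> {a..b}; x \<notin> N; y \<in> {a..b}; norm (y-x) < d x\<rbrakk>
            \<Longrightarrow> norm (h y - h x - (y-x) *\<^sub>R g x) \<le> c * norm (y-x)"
      by (metis DiffI)
    show "\<exists>\<gamma>. gauge \<gamma> \<and> (\<forall>\<D>. \<D> tagged_division_of {a..b} \<and> \<gamma> fine \<D> \<longrightarrow>
        norm (sum (\<lambda>(x,k). measure lborel k *\<^sub>R g x) \<D> - (h b - h a)) < e)"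
    proof (intro exI conjI allI impI)
      show "gauge (\<lambda>x. ball x (d x))"
        using d(1) gauge_ball_dependent by blast
    next
      fix p
      assume "p tagged_division_of {a..b} \<and> (\<lambda>x. ball x (d x)) fine p"
      then have p: "p tagged_division_of {a..b}" and fine: "(\<lambda>x. ball x (d x)) fine p" by auto
      define p' where "p' = {(x, k) \<in> p. x \<in> N}"
      have p'p: "p' \<subseteq> p" and finp: "finite p" using p by (auto simp: p'_def)
      have part: "p' tagged_partial_division_of {a..b}"
        using p p'p by (meson tagged_division_of_def tagged_partial_division_subset)
      have div: "snd ` p' division_of \<Union>(snd ` p')"
        using partial_division_of_tagged_division[OF part] .
      have "\<Union>(snd ` p') \<subseteq> U"
        using fine d(2) unfolding p'_def fine_def by fastforce
      then have "(\<Sum>k\<in>snd ` p'. Sup k - Inf k) < \<delta>"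
        using tagged_partial_division_of_sum_length_le[OF part Um] U\<delta> by linarith
      moreover have "\<Union>(snd ` p') \<subseteq> {a..b}"
        using p p'p by fastforce
      ultimately have "(\<Sum>k\<in>snd ` p'. norm (h (Sup k) - h (Inf k))) < e / 2"
        using \<delta>[OF div] by blast
      moreover have "(\<Sum>(x, k)\<in>p'. norm (h (Sup k) - h (Inf k)))
          = (\<Sum>k\<in>snd ` p'. norm (h (Sup k) - h (Inf k)))"
      proof -
        \<comment> \<open>The passage from tagged pairs to intervals requires a summand that
          vanishes on every interval with empty interior, and \<open>Sup {}\<close> and
          \<open>Inf {}\<close> have no useful values; hence the default 0.\<close>
        define l where "l k = (if k = {} then 0 else norm (h (Sup k) - h (Inf k)))" for k
        have l: "norm (h (Sup k) - h (Inf k)) = l k" if "k \<in> snd ` p'" for k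
          using that tagged_partial_division_ofD(2)[OF part] by (fastforce simp: l_def)
        have "(\<Sum>(x, k)\<in>p'. l k) = (\<Sum>k\<in>snd ` p'. l k)"
        proof (rule sum.over_tagged_division_lemma[OF tagged_partial_division_of_Union_self[OF part]])
          fix u v :: real assume "box u v = {}"
          then show "l (cbox u v) = 0"
            by (cases "u = v") (auto simp: l_def)
        qed
        then show ?thesis
          by (auto simp: l split_def cong: sum.cong)
      qed
      ultimately have p'_sum: "(\<Sum>(x, k)\<in>p'. norm (h (Sup k) - h (Inf k))) < e / 2" by simp
      have ba: "b - a = (\<Sum>(x,K)\<in>p. Sup K - Inf K)" "h b - h a = (\<Sum>(x,K)\<in>p. h(Sup K) - h(Inf K))"
        using additive_tagged_division_1[where f= "\<lambda>x. x", OF \<open>a \<le> b\<close> p]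
          additive_tagged_division_1[where f= h, OF \<open>a \<le> b\<close> p] by auto
      have "norm ((\<Sum>(x,k)\<in>p. measure lborel k *\<^sub>R g x) - (h b - h a))
          = norm (\<Sum>(x,k)\<in>p. measure lborel k *\<^sub>R g x - (h(Sup k) - h(Inf k)))"
        unfolding ba(2) by (simp add: sum_subtractf split_def)
      also have "\<dots> \<le> (\<Sum>(x,k)\<in>p. c * (Sup k - Inf k) +
          (if x \<in> N then norm (h (Sup k) - h (Inf k)) else 0))"
      proof (rule sum_norm_le, safe)
        fix x K assume xK: "(x, K) \<in> p"
        then obtain u v where K: "K = {u..v}" and "x \<in> K" and kab: "K \<subseteq> {a..b}"
          using p by (metis box_real(2) tagged_division_ofD(2,3,4))
        then have uv: "u \<le> x" "x \<le> v" by auto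
        have ball: "u \<in> ball x (d x)" "v \<in> ball x (d x)"
          using fineD[OF fine xK] uv unfolding K by (force simp del: mem_ball)+
        show "norm (measure lborel K *\<^sub>R g x - (h (Sup K) - h (Inf K))) \<le> c * (Sup K - Inf K) +
          (if x \<in> N then norm (h (Sup K) - h (Inf K)) else 0)"
        proof (cases "x \<in> N")
          case True
          then show ?thesis
            using uv \<open>c > 0\<close> by (simp add: K g_def norm_minus_commute)
        next
          case False
          \<comment> \<open>The tag \<open>x\<close> lies between \<open>u\<close> and
            \<open>v\<close>, so the two one-sided errors add up to \<open>c\<close> times the
            length of the interval.\<close>
          have "norm ((v - u) *\<^sub>R g x - (h v - h u))
              = norm ((h u - h x - (u - x) *\<^sub>R g x) - (h v - h x - (v - x) *\<^sub>R g x))"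
            by (auto simp: algebra_simps)
          also have "\<dots> \<le> norm (h u - h x - (u - x) *\<^sub>R g x) + norm (h v - h x - (v - x) *\<^sub>R g x)"
            by (rule norm_triangle_ineq4)
          also have "\<dots> \<le> c * norm (u - x) + c * norm (v - x)"
            using ball kab uv False unfolding K
            by (intro add_mono d(3)) (auto simp: dist_real_def)
          also have "\<dots> = c * (v - u)" using uv by (simp add: algebra_simps)
          finally show ?thesis using False uv by (simp add: K)
        qed
      qed
      also have "\<dots> = c * (b - a) + (\<Sum>(x,k)\<in>p. if x \<in> N then norm (h (Sup k) - h (Inf k)) else 0)"
        unfolding ba(1) by (simp add: sum.distrib sum_distrib_left split_def)
      also have "(\<Sum>(x,k)\<in>p. if x \<in> N then norm (h (Sup k) - h (Inf k)) else 0)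
          = (\<Sum>(x, k)\<in>p'. norm (h (Sup k) - h (Inf k)))"
        by (rule sum.mono_neutral_cong_right) (use finp in \<open>auto simp: p'_def split: if_splits\<close>)
      finally show "norm ((\<Sum>(x,k)\<in>p. measure lborel k *\<^sub>R g x) - (h b - h a)) < e"
        using c p'_sum by linarith
    qed
  qed
  then show ?thesis
    by (rule has_integral_spike[OF N, rotated]) (auto simp: g_def)
qed

text \<open>By the integral formula \<open>h\<close> is a primitive of the continuous function
  \<open>h'\<close>, so the derivative equation extends to the points of the null set.\<close>

corollary absolutely_cont_on_has_vector_derivative:
  fixes h :: "real \<Rightarrow> 'a::banach"
  assumes ac: "absolutely_cont_on h {a..b}" and N: "negligible N"
    and deriv: "\<And>x. x \<in> {a..b} - N \<Longrightarrow> (h has_vector_derivative h' x) (at x within {a..b})"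
    and cont: "continuous_on {a..b} h'" and x: "x \<in> {a..b}"
  shows "(h has_vector_derivative h' x) (at x within {a..b})"
proof (rule has_vector_derivative_transform[OF x])
  show "((\<lambda>u. h a + integral {a..u} h') has_vector_derivative h' x) (at x within {a..b})"
    using integral_has_vector_derivative[OF cont x] by (auto intro!: derivative_eq_intros)
next
  fix y assume y: "y \<in> {a..b}"
  then have sub: "{a..y} \<subseteq> {a..b}" by auto
  have "absolutely_cont_on h {a..y}"
    using ac sub unfolding absolutely_cont_on_def by (meson order_trans)
  then have "(h' has_integral h y - h a) {a..y}"
    using y sub N
    by (intro absolutely_cont_on_has_integral)
      (auto intro: has_vector_derivative_within_subset[OF deriv])
  then show "h y = h a + integral {a..y} h'"
    by (simp add: integral_unique)
qed

section \<open>Hybrid time domains and solutions\<close>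

text \<open>Cutting \<open>E\<close> off at \<open>(t, j)\<close> leaves a compact time domain,
  whose breakpoints serve as \<open>s\<close>. The one numbered \<open>Suc j\<close> is
  \<open>t\<close>, because the cut contains \<open>(t, j)\<close> and no later time.\<close>

lemma hybrid_time_domain_segments:
  assumes E: "hybrid_time_domain E" and tj: "(t, j) \<in> E"
  obtains s :: "nat \<Rightarrow> real" where "s 0 = 0" "s (Suc j) = t" "\<And>i. i \<le> j \<Longrightarrow> s i \<le> s (Suc i)"
    "\<And>i. i \<le> j \<Longrightarrow> {s i..s (Suc i)} \<subseteq> flow_interval E i"
proof -
  have "t \<ge> 0" using assms by (auto simp: hybrid_time_domain_def)
  have "compact_hybrid_time_domain (E \<inter> ({0..t} \<times> {..j}))"
    using assms by (auto simp: hybrid_time_domain_def)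
  then obtain N s where s0: "s 0 = 0" and mono: "\<And>i. i < N \<Longrightarrow> s i \<le> s (Suc i)"
    and eq: "E \<inter> ({0..t} \<times> {..j}) = (\<Union>i<N. {s i..s (Suc i)} \<times> {i})"
    unfolding compact_hybrid_time_domain_def by blast
  have in_iff: "(u, i) \<in> E \<and> 0 \<le> u \<and> u \<le> t \<and> i \<le> j \<longleftrightarrow> i < N \<and> s i \<le> u \<and> u \<le> s (Suc i)" for u i
  proof -
    have "(u, i) \<in> E \<inter> ({0..t} \<times> {..j}) \<longleftrightarrow> (u, i) \<in> (\<Union>i<N. {s i..s (Suc i)} \<times> {i})"
      using eq by simp
    then show ?thesis by auto
  qed
  have "j < N" and t: "s j \<le> t" "t \<le> s (Suc j)"
    using in_iff[of t j] tj \<open>t \<ge> 0\<close> by auto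
  moreover have "s (Suc j) \<le> t"
    using in_iff[of "s (Suc j)" j] mono[OF \<open>j < N\<close>] \<open>j < N\<close> by auto
  moreover have "{s i..s (Suc i)} \<subseteq> flow_interval E i" if "i \<le> j" for i
  proof
    fix u assume "u \<in> {s i..s (Suc i)}"
    then show "u \<in> flow_interval E i"
      using in_iff[of u i] that \<open>j < N\<close> by (simp add: flow_interval_def)
  qed
  moreover have "s i \<le> s (Suc i)" if "i \<le> j" for i
    using mono \<open>j < N\<close> that by simp
  ultimately show ?thesis
    using that[of s, OF s0] t by (metis order_antisym)
qed

text \<open>Finitely many flow segments and jumps lead from \<open>(0, 0)\<close> to any point of
  the domain. The flow case allows \<open>a = b\<close>, since several jumps may share one
  time.\<close>

lemma hybrid_time_domain_induct [consumes 2, case_names start flow jump]: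
  assumes E: "hybrid_time_domain E" and tj: "(t, j) \<in> E"
    and start: "P 0 0"
    and flow: "\<And>a b j. a \<le> b \<Longrightarrow> {a..b} \<subseteq> flow_interval E j \<Longrightarrow> P a j \<Longrightarrow> P b j"
    and jump: "\<And>t j. (t, j) \<in> E \<Longrightarrow> (t, Suc j) \<in> E \<Longrightarrow> P t j \<Longrightarrow> P t (Suc j)"
  shows "P t j"
proof -
  obtain s where s: "s 0 = 0" "s (Suc j) = t" "\<And>i. i \<le> j \<Longrightarrow> s i \<le> s (Suc i)"
    "\<And>i. i \<le> j \<Longrightarrow> {s i..s (Suc i)} \<subseteq> flow_interval E i"
    using hybrid_time_domain_segments[OF E tj] by blast
  \<comment> \<open>The claim concerns the right end of each segment, where the next jump takes
    place.\<close>
  have "P (s (Suc i)) i" if "i \<le> j" for i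
    using that
  proof (induction i)
    case 0
    then show ?case using flow[of "s 0" "s (Suc 0)" 0] s(3,4)[of 0] start by (simp add: s(1))
  next
    case (Suc i)
    have "(s (Suc i), i) \<in> E" "(s (Suc i), Suc i) \<in> E"
      using s(3,4)[of i] s(3,4)[of "Suc i"] Suc.prems by (force simp: flow_interval_def)+
    then have "P (s (Suc i)) (Suc i)" using jump Suc by simp
    then show ?case using flow s(3,4)[of "Suc i"] Suc.prems by blast
  qed
  then show ?thesis using s(2) by blast
qed

text \<open>A continuous right-hand side turns the almost-everywhere differential equation of a solution
  into a classical one.\<close>

lemma hybrid_solution_flow:
  fixes \<phi> :: "real \<Rightarrow> nat \<Rightarrow> 'a::banach"
  assumes sol: "hybrid_solution H E \<phi>" and ab: "a < b" and sub: "{a..b} \<subseteq> flow_interval E j"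
    and cl: "closed (flow_set H)" and cont: "continuous_on (flow_set H) (flow_map H)"
  shows "\<And>t. t \<in> {a..b} \<Longrightarrow> \<phi> t j \<in> flow_set H"
    and "\<And>t. t \<in> {a..b} \<Longrightarrow>
          ((\<lambda>s. \<phi> s j) has_vector_derivative flow_map H (\<phi> t j)) (at t within {a..b})"
proof -
  have ac: "absolutely_cont_on (\<lambda>t. \<phi> t j) {a..b}"
    using sol sub by (auto simp: hybrid_solution_def hybrid_arc_def locally_absolutely_cont_on_def)
  have c: "continuous_on {a..b} (\<lambda>t. \<phi> t j)"
    by (rule absolutely_cont_on_imp_continuous_on[OF ac])
  have int: "{a<..<b} \<subseteq> interior (flow_interval E j)"
    using interior_mono[OF sub] by simp
  then have ne: "interior (flow_interval E j) \<noteq> {}"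
    using ab dense by fastforce
  then have "\<phi> t j \<in> flow_set H" if "t \<in> {a<..<b}" for t
    using sol that int unfolding hybrid_solution_def by blast
  \<comment> \<open>Solutions are only required to lie in the flow set at interior times; continuity
    and closedness add the endpoints.\<close>
  then have "(\<lambda>t. \<phi> t j) ` {a<..<b} \<subseteq> flow_set H" by blast
  then have "(\<lambda>t. \<phi> t j) ` closure {a<..<b} \<subseteq> flow_set H"
    using c ab by (intro image_closure_subset[OF _ cl]) auto
  then show C: "\<phi> t j \<in> flow_set H" if "t \<in> {a..b}" for t
    using that ab by auto
  have "AE t in lebesgue. t \<in> flow_interval E j \<longrightarrow>
    ((\<lambda>s. \<phi> s j) has_vector_derivative flow_map H (\<phi> t j)) (at t within flow_interval E j)"
    using sol ne unfolding hybrid_solution_def by blast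
  then obtain N where N: "N \<in> null_sets lebesgue" and
    "{t. \<not> (t \<in> flow_interval E j \<longrightarrow>
     ((\<lambda>s. \<phi> s j) has_vector_derivative flow_map H (\<phi> t j)) (at t within flow_interval E j))} \<subseteq> N"
    unfolding eventually_ae_filter by auto
  then have d: "((\<lambda>s. \<phi> s j) has_vector_derivative flow_map H (\<phi> t j)) (at t within {a..b})"
    if "t \<in> {a..b} - N" for t
    using that sub by (blast intro: has_vector_derivative_within_subset)
  have "continuous_on {a..b} (\<lambda>t. flow_map H (\<phi> t j))"
    using C by (intro continuous_on_compose2[OF cont c]) auto
  then show "((\<lambda>s. \<phi> s j) has_vector_derivative flow_map H (\<phi> t j)) (at t within {a..b})"
    if "t \<in> {a..b}" for t
    using absolutely_cont_on_has_vector_derivative[OF ac _ d] N that negligible_iff_null_sets by blast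
qed

section \<open>Gradients and strong monotonicity\<close>

text \<open>On coordinate lines the total derivative gives the partial derivatives that define
  \<open>grad\<close>; expansion in the standard basis then covers every direction.\<close>

lemma grad_has_derivative:
  fixes J :: "real^'n::finite \<Rightarrow> real"
  assumes "J differentiable (at x)"
  shows "(J has_derivative (\<lambda>h. grad J x \<bullet> h)) (at x)"
proof -
  obtain D where D: "(J has_derivative D) (at x)"
    using assms by (auto simp: differentiable_def)
  interpret D: bounded_linear D by (rule has_derivative_bounded_linear[OF D])
  have "grad J x $ i = D (axis i 1)" for i
  proof -
    have "((\<lambda>s. J (x + s *\<^sub>R axis i 1)) has_derivative (\<lambda>s. D (s *\<^sub>R axis i 1))) (at 0)"
      by (rule has_derivative_compose[where g = J and f = "\<lambda>s. x + s *\<^sub>R axis i 1"])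
         (use D in \<open>auto intro!: derivative_eq_intros\<close>)
    then have "((\<lambda>s. J (x + s *\<^sub>R axis i 1)) has_field_derivative D (axis i 1)) (at 0)"
      by (simp add: has_field_derivative_def D.scaleR mult.commute[of _ "D (axis i 1)"])
    then show ?thesis
      by (simp add: grad_def partial_deriv_def DERIV_imp_deriv)
  qed
  then have "D h = grad J x \<bullet> h" for h
    by (subst basis_expansion[symmetric, of h])
       (simp add: D.sum D.scaleR inner_vec_def mult.commute scalar_mult_eq_scaleR)
  then show ?thesis using D by presburger
qed

text \<open>On the segment from \<open>x\<close> to \<open>y\<close>, \<open>\<psi>\<close> is
  \<open>J\<close> minus the linear and quadratic terms of the bound. Strong monotonicity makes it
  nondecreasing, and its values at both ends are compared.\<close>

lemma strongly_convex_lower_bound: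
  fixes J :: "'a::real_inner \<Rightarrow> real"
  assumes deriv: "\<And>x. (J has_derivative (\<lambda>h. g x \<bullet> h)) (at x)"
    and mono: "\<And>x y. (g x - g y) \<bullet> (x - y) \<ge> \<kappa> * (norm (x - y))\<^sup>2"
  shows "J y \<ge> J x + g x \<bullet> (y - x) + \<kappa> / 2 * (norm (y - x))\<^sup>2"
proof -
  define d where "d = y - x"
  define \<psi> where "\<psi> t = J (x + t *\<^sub>R d) - t * (g x \<bullet> d) - \<kappa> / 2 * t\<^sup>2 * (norm d)\<^sup>2" for t
  have "(\<psi> has_real_derivative (g (x + t *\<^sub>R d) \<bullet> d - g x \<bullet> d - \<kappa> * t * (norm d)\<^sup>2)) (at t)" for t
  proof -
    have "((\<lambda>t. J (x + t *\<^sub>R d)) has_derivative (\<lambda>s. g (x + t *\<^sub>R d) \<bullet> (s *\<^sub>R d))) (at t)"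
      by (rule has_derivative_compose[where g = J and f = "\<lambda>t. x + t *\<^sub>R d", OF _ deriv])
         (auto intro!: derivative_eq_intros)
    then have "((\<lambda>t. J (x + t *\<^sub>R d)) has_real_derivative (g (x + t *\<^sub>R d) \<bullet> d)) (at t)"
      by (simp add: has_field_derivative_def mult.commute[of _ "_ \<bullet> _"])
    then show ?thesis
      unfolding \<psi>_def by (auto intro!: derivative_eq_intros)
  qed
  moreover have "g (x + t *\<^sub>R d) \<bullet> d - g x \<bullet> d - \<kappa> * t * (norm d)\<^sup>2 \<ge> 0" if "0 \<le> t" for t
  proof (cases "t = 0")
    case False
    \<comment> \<open>Monotonicity is applied to \<open>x + t d\<close> and \<open>x\<close>, which
      leaves one extra factor \<open>t\<close> to cancel.\<close>
    have "t * (g (x + t *\<^sub>R d) \<bullet> d - g x \<bullet> d - \<kappa> * t * (norm d)\<^sup>2) \<ge> 0"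
      using mono[of "x + t *\<^sub>R d" x] by (simp add: inner_diff_left power_mult_distrib algebra_simps power2_eq_square)
    then show ?thesis using False that by (simp add: zero_le_mult_iff)
  qed simp
  ultimately have "\<exists>y. (\<psi> has_real_derivative y) (at t) \<and> y \<ge> 0" if "0 \<le> t" for t
    using that by blast
  then have "\<psi> 0 \<le> \<psi> 1"
    by (intro DERIV_nonneg_imp_nondecreasing[of 0 1 \<psi>]) simp_all
  then show ?thesis by (simp add: \<psi>_def d_def)
qed

text \<open>For a suitable step \<open>c\<close> the map \<open>x - c *\<^sub>R G x\<close> is a
  contraction, and its fixed points are the zeros of \<open>G\<close>.\<close>

lemma strongly_monotone_Lipschitz_ex1_zero:
  fixes G :: "'a::{real_inner, complete_space} \<Rightarrow> 'a"
  assumes "\<kappa> > 0" and "L > 0"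
    and mono: "\<And>x y. (G x - G y) \<bullet> (x - y) \<ge> \<kappa> * (norm (x - y))\<^sup>2"
    and lip: "\<And>x y. norm (G x - G y) \<le> L * norm (x - y)"
  shows "\<exists>!x. G x = 0"
proof -
  \<comment> \<open>This step minimizes the bound
    \<open>1 - 2 * c * \<kappa> + c\<^sup>2 * L\<^sup>2\<close> on the squared contraction
    factor.\<close>
  define c where "c = \<kappa> / L\<^sup>2"
  \<comment> \<open>The maximum keeps the radicand nonnegative without a comparison of
    \<open>\<kappa>\<close> and \<open>L\<close>.\<close>
  define r where "r = sqrt (max 0 (1 - \<kappa>\<^sup>2 / L\<^sup>2))"
  have "c > 0" "0 \<le> r" using assms by (auto simp: c_def r_def)
  have "r < 1" using assms by (simp add: r_def)
  have "norm ((x - c *\<^sub>R G x) - (y - c *\<^sub>R G y)) \<le> r * norm (x - y)" for x y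
  proof (rule power2_le_imp_le)
    have "(norm ((x - c *\<^sub>R G x) - (y - c *\<^sub>R G y)))\<^sup>2
        = (norm (x - y))\<^sup>2 - 2 * c * ((G x - G y) \<bullet> (x - y)) + c\<^sup>2 * (norm (G x - G y))\<^sup>2"
      unfolding power2_norm_eq_inner
      by (simp add: inner_diff_left inner_diff_right inner_commute algebra_simps power2_eq_square)
    also have "\<dots> \<le> (norm (x - y))\<^sup>2 - 2 * c * (\<kappa> * (norm (x - y))\<^sup>2) + c\<^sup>2 * (L * norm (x - y))\<^sup>2"
      using \<open>c > 0\<close> by (intro add_mono diff_mono mult_left_mono mono power_mono lip) auto
    also have "\<dots> = (1 - \<kappa>\<^sup>2 / L\<^sup>2) * (norm (x - y))\<^sup>2"
      using \<open>L > 0\<close> by (simp add: c_def field_simps power2_eq_square)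
    also have "\<dots> \<le> (r * norm (x - y))\<^sup>2"
      unfolding r_def power_mult_distrib by (intro mult_right_mono) auto
    finally show "(norm ((x - c *\<^sub>R G x) - (y - c *\<^sub>R G y)))\<^sup>2 \<le> (r * norm (x - y))\<^sup>2" .
  qed (use \<open>0 \<le> r\<close> in simp)
  then have "\<exists>!x. x - c *\<^sub>R G x = x"
    using banach_fix_type[of r "\<lambda>x. x - c *\<^sub>R G x"] \<open>0 \<le> r\<close> \<open>r < 1\<close> by (simp add: dist_norm)
  then show ?thesis using \<open>c > 0\<close> by simp
qed

section \<open>Lyapunov function of the restarting system\<close>

text \<open>The Lyapunov analysis works with a gradient field \<open>F\<close> with potential
  \<open>U\<close> and a field \<open>R\<close>, both centred at the equilibrium \<open>s\<close>.
  They are later the two parts of \<open>G\<close> shifted by their values at \<open>s\<close>, and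
  \<open>U\<close> is then the Bregman divergence of \<open>J\<close> at \<open>s\<close>. The
  bounds on \<open>T\<close> appear free of the square root and the minimum.\<close>

locale restarting_split =
  fixes G F R :: "real^'n::finite \<Rightarrow> real^'n" and U :: "real^'n \<Rightarrow> real" and s :: "real^'n"
    and \<kappa> L\<^sub>F L\<^sub>R T0 T \<eta> :: real
  assumes G_eq: "G x = F x + R x"
    and G_cont: "continuous_on UNIV G"
    and U_deriv: "(U has_derivative (\<lambda>h. F x \<bullet> h)) (at x)"
    and U_lower: "\<kappa> / 2 * (norm (x - s))\<^sup>2 \<le> U x"
    and U_upper: "U x \<le> L\<^sub>F * (norm (x - s))\<^sup>2"
    and F_inner: "U x + \<kappa> / 2 * (norm (x - s))\<^sup>2 \<le> F x \<bullet> (x - s)"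
    and R_mono: "0 \<le> R x \<bullet> (x - s)"
    and R_bound: "norm (R x) \<le> L\<^sub>R * norm (x - s)"
    and \<kappa>: "0 < \<kappa>" and L\<^sub>F: "0 < L\<^sub>F" and L\<^sub>R: "0 < L\<^sub>R"
    and T0: "0 < T0" and T0_less_T: "T0 < T"
    and \<eta>: "0 < \<eta>" "\<eta> < 1"
    and T_lower: "T0\<^sup>2 + 4 * \<eta>\<^sup>2 / \<kappa> < T\<^sup>2"
    and T_upper: "T * L\<^sub>R \<le> 2 * (3 * (1 - \<eta>))" "T * L\<^sub>R \<le> 2 * (\<kappa> * \<eta>)"
begin

abbreviation "sys \<equiv> restarting_system G \<eta> T0 T"

abbreviation "A \<equiv> {s} \<times> {0 :: real^'n} \<times> {T0..T}"

text \<open>The weight of the second summand is the one that cancels the cross term in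
  \<open>(q - s) \<bullet> p\<close> along the flow.\<close>

definition V :: "'n state \<Rightarrow> real" where
  "V = (\<lambda>(q, p, \<tau>). (norm ((2 * \<eta>) *\<^sub>R (q - s) + \<tau> *\<^sub>R p))\<^sup>2 / 2
          + 3 * \<eta> * (1 - \<eta>) * (norm (q - s))\<^sup>2 + \<tau>\<^sup>2 * U q)"

lemma flow_set_sys: "flow_set sys = {(q, p, \<tau>). \<tau> \<in> {T0..T}}"
  and jump_set_sys: "jump_set sys = {(q, p, \<tau>). \<tau> = T}"
  and jump_map_sys: "jump_map sys = (\<lambda>(q, p, \<tau>). (q, 0, T0))"
  and flow_map_sys: "flow_map sys = (\<lambda>(q, p, \<tau>). (p, - (3 / \<tau>) *\<^sub>R p - G q, \<eta>))"
  by (simp_all add: restarting_system_def)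

lemma closed_flow_set_sys: "closed (flow_set sys)"
proof -
  have "flow_set sys = UNIV \<times> UNIV \<times> {T0..T}"
    by (auto simp: flow_set_sys)
  then show ?thesis by (simp add: closed_Times)
qed

lemma continuous_flow_map_sys: "continuous_on (flow_set sys) (flow_map sys)"
  unfolding flow_map_sys flow_set_sys split_def
  using T0 by (auto intro!: continuous_intros continuous_on_compose2[OF G_cont])

section \<open>Decrease of the Lyapunov function along flows and at jumps\<close>

text \<open>The left side is the derivative of \<open>V\<close> along the flow. The terms in
  \<open>(q - s) \<bullet> p\<close> and \<open>F q \<bullet> p\<close> cancel, and only the product
  \<open>R q \<bullet> p\<close> remains without a sign.\<close>

lemma Lie_derivative_nonpos:
  assumes \<tau>: "\<tau> \<in> {T0..T}"
  shows "((2 * \<eta>) *\<^sub>R (q - s) + \<tau> *\<^sub>R p) \<bullet>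
      ((2 * \<eta>) *\<^sub>R p + (\<eta> *\<^sub>R p + \<tau> *\<^sub>R (- (3 / \<tau>) *\<^sub>R p - G q)))
      + 6 * \<eta> * (1 - \<eta>) * ((q - s) \<bullet> p) + (2 * \<tau> * \<eta> * U q + \<tau>\<^sup>2 * (F q \<bullet> p)) \<le> 0"
    (is "?lhs \<le> 0")
proof -
  define e where "e = q - s"
  have "\<tau> > 0" using \<tau> T0 by auto
  then have "(2 * \<eta>) *\<^sub>R p + (\<eta> *\<^sub>R p + \<tau> *\<^sub>R (- (3 / \<tau>) *\<^sub>R p - G q))
      = (3 * \<eta> - 3) *\<^sub>R p - \<tau> *\<^sub>R (F q + R q)"
    by (simp add: G_eq algebra_simps flip: scaleR_add_left)
  then have "?lhs = ((2 * \<eta>) *\<^sub>R e + \<tau> *\<^sub>R p) \<bullet> ((3 * \<eta> - 3) *\<^sub>R p - \<tau> *\<^sub>R (F q + R q))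
      + 6 * \<eta> * (1 - \<eta>) * (e \<bullet> p) + (2 * \<tau> * \<eta> * U q + \<tau>\<^sup>2 * (F q \<bullet> p))"
    by (simp add: e_def)
  also have "\<dots> = \<tau> * (- (3 * (1 - \<eta>) * (norm p)\<^sup>2) - 2 * \<eta> * (F q \<bullet> e - U q)
      - 2 * \<eta> * (R q \<bullet> e) - \<tau> * (R q \<bullet> p))"
    unfolding power2_norm_eq_inner
    by (simp add: inner_add_left inner_add_right inner_diff_left inner_diff_right inner_commute
        algebra_simps power2_eq_square)
  also have "\<dots> \<le> 0"
  proof -
    \<comment> \<open>Young's inequality splits the product into squares. The two bounds in
      \<open>T_upper\<close> match them with the damping in \<open>p\<close> and with the margin
      \<open>\<kappa> / 2 * (norm e)\<^sup>2\<close> from \<open>F_inner\<close>.\<close>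
    have "- (\<tau> * (R q \<bullet> p)) \<le> \<tau> * (norm (R q) * norm p)"
      using \<open>\<tau> > 0\<close> Cauchy_Schwarz_ineq2[of "R q" p]
      by (metis abs_le_D2 mult_le_cancel_left_pos mult_minus_right)
    also have "\<dots> \<le> T * (L\<^sub>R * norm e * norm p)"
      using \<tau> \<open>\<tau> > 0\<close> R_bound[of q] L\<^sub>R unfolding e_def by (intro mult_mono) auto
    also have "\<dots> = T * L\<^sub>R / 2 * (2 * norm e * norm p)" by simp
    also have "\<dots> \<le> T * L\<^sub>R / 2 * ((norm e)\<^sup>2 + (norm p)\<^sup>2)"
      using T0 T0_less_T L\<^sub>R by (intro mult_left_mono sum_squares_bound) auto
    also have "\<dots> \<le> \<kappa> * \<eta> * (norm e)\<^sup>2 + 3 * (1 - \<eta>) * (norm p)\<^sup>2"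
      unfolding distrib_left using T_upper by (intro add_mono mult_right_mono) auto
    finally have 1: "- (\<tau> * (R q \<bullet> p)) \<le> \<kappa> * \<eta> * (norm e)\<^sup>2 + 3 * (1 - \<eta>) * (norm p)\<^sup>2" .
    have 2: "2 * \<eta> * (F q \<bullet> e - U q) \<ge> 2 * \<eta> * (\<kappa> / 2 * (norm e)\<^sup>2)"
      using F_inner[of q] \<eta> unfolding e_def by (intro mult_left_mono) auto
    have 3: "2 * \<eta> * (R q \<bullet> e) \<ge> 0" using \<eta> R_mono[of q] unfolding e_def by simp
    show ?thesis
      using \<open>\<tau> > 0\<close> 1 2 3 by (intro mult_nonneg_nonpos) (auto simp: algebra_simps)
  qed
  finally show ?thesis .
qed

text \<open>Here \<open>p'\<close> is left free; inserting the flow map yields the expression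
  bounded in \<open>Lie_derivative_nonpos\<close>.\<close>

lemma V_has_derivative:
  assumes q: "(q has_vector_derivative p t) (at t)" and p: "(p has_vector_derivative p') (at t)"
    and \<tau>: "(\<tau> has_real_derivative \<eta>) (at t)"
  shows "((\<lambda>t. V (q t, p t, \<tau> t)) has_real_derivative
     ((2 * \<eta>) *\<^sub>R (q t - s) + \<tau> t *\<^sub>R p t) \<bullet> ((2 * \<eta>) *\<^sub>R p t + (\<eta> *\<^sub>R p t + \<tau> t *\<^sub>R p'))
      + 6 * \<eta> * (1 - \<eta>) * ((q t - s) \<bullet> p t) + (2 * \<tau> t * \<eta> * U (q t) + (\<tau> t)\<^sup>2 * (F (q t) \<bullet> p t))) (at t)"
proof -
  have U: "((\<lambda>t. U (q t)) has_real_derivative F (q t) \<bullet> p t) (at t)"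
    using has_derivative_compose[OF q[unfolded has_vector_derivative_def] U_deriv]
    by (simp add: has_field_derivative_def mult.commute[of _ "_ \<bullet> _"])
  note q' = q[unfolded has_vector_derivative_def] and p' = p[unfolded has_vector_derivative_def]
  note \<tau>' = \<tau>[unfolded has_field_derivative_def]
  have 1: "((\<lambda>t. (q t - s) \<bullet> (q t - s)) has_real_derivative 2 * ((q t - s) \<bullet> p t)) (at t)"
    unfolding has_field_derivative_def
    by (rule derivative_eq_intros q' refl)+ (simp add: fun_eq_iff inner_commute)
  have 2: "((\<lambda>t. ((2 * \<eta>) *\<^sub>R (q t - s) + \<tau> t *\<^sub>R p t) \<bullet> ((2 * \<eta>) *\<^sub>R (q t - s) + \<tau> t *\<^sub>R p t))
    has_real_derivative 2 * (((2 * \<eta>) *\<^sub>R (q t - s) + \<tau> t *\<^sub>R p t) \<bullet>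
     ((2 * \<eta>) *\<^sub>R p t + (\<eta> *\<^sub>R p t + \<tau> t *\<^sub>R p')))) (at t)"
    unfolding has_field_derivative_def
    by (rule derivative_eq_intros q' p' \<tau>' refl)+
       (simp add: fun_eq_iff inner_commute inner_add_left inner_add_right algebra_simps)
  define k where "k = ((2 * \<eta>) *\<^sub>R (q t - s) + \<tau> t *\<^sub>R p t) \<bullet>
     ((2 * \<eta>) *\<^sub>R p t + (\<eta> *\<^sub>R p t + \<tau> t *\<^sub>R p'))"
  show ?thesis
    unfolding V_def power2_norm_eq_inner prod.case k_def[symmetric]
    by (rule DERIV_cong[OF DERIV_add[OF DERIV_add[OF DERIV_cdivide[OF 2[folded k_def]]
            DERIV_cmult[OF 1]] DERIV_mult[OF DERIV_power[OF \<tau>] U]]])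
       (simp add: algebra_simps)
qed

text \<open>The classical equations hold on a nondegenerate interval, so \<open>V\<close> has
  nonpositive derivative inside it and the clock grows at rate \<open>\<eta>\<close>. The assumption
  on \<open>\<phi> a j\<close> covers \<open>a = b\<close>, where the flow condition of a solution
  may be void.\<close>

lemma flow_step:
  assumes sol: "hybrid_solution sys E \<phi>" and ab: "a \<le> b" and sub: "{a..b} \<subseteq> flow_interval E j"
    and a: "\<phi> a j \<in> flow_set sys"
  shows "\<phi> b j \<in> flow_set sys" "V (\<phi> b j) \<le> V (\<phi> a j)"
    "snd (snd (\<phi> b j)) = snd (snd (\<phi> a j)) + \<eta> * (b - a)"
proof -
  have "\<phi> b j \<in> flow_set sys \<and> V (\<phi> b j) \<le> V (\<phi> a j) \<and>
    snd (snd (\<phi> b j)) = snd (snd (\<phi> a j)) + \<eta> * (b - a)"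
  proof (cases "a = b")
    case False
    then have "a < b" using ab by simp
    note fl = hybrid_solution_flow[OF sol this sub closed_flow_set_sys continuous_flow_map_sys]
    define q p \<tau> where "q t = fst (\<phi> t j)" and "p t = fst (snd (\<phi> t j))"
      and "\<tau> t = snd (snd (\<phi> t j))" for t
    have \<phi>: "\<phi> t j = (q t, p t, \<tau> t)" for t by (simp add: q_def p_def \<tau>_def)
    have \<tau>C: "\<tau> t \<in> {T0..T}" if "t \<in> {a..b}" for t
      using fl(1)[OF that] by (simp add: \<phi> flow_set_sys)
    have D: "((\<lambda>s. \<phi> s j) has_vector_derivative (p t, - (3 / \<tau> t) *\<^sub>R p t - G (q t), \<eta>)) (at t within {a..b})"
      if "t \<in> {a..b}" for t
      using fl(2)[OF that] by (simp add: \<phi> flow_map_sys)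
    note snd_D = bounded_linear.has_vector_derivative[OF bounded_linear_snd D]
    have q': "(q has_vector_derivative p t) (at t within {a..b})"
      and p': "(p has_vector_derivative - (3 / \<tau> t) *\<^sub>R p t - G (q t)) (at t within {a..b})"
      and \<tau>': "(\<tau> has_real_derivative \<eta>) (at t within {a..b})" if "t \<in> {a..b}" for t
      using bounded_linear.has_vector_derivative[OF bounded_linear_fst D[OF that]]
        bounded_linear.has_vector_derivative[OF bounded_linear_fst snd_D[OF that]]
        bounded_linear.has_vector_derivative[OF bounded_linear_snd snd_D[OF that]]
      by (simp_all add: q_def[abs_def] p_def[abs_def] \<tau>_def[abs_def]
          has_real_derivative_iff_has_vector_derivative)
    have at: "at t within {a..b} = at t" if "t \<in> {a<..<b}" for t
      using that by (simp add: at_within_Icc_at)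
    have cont: "continuous_on {a..b} q" "continuous_on {a..b} p" "continuous_on {a..b} \<tau>"
      using q' p' \<tau>'
      by (meson has_vector_derivative_continuous DERIV_continuous continuous_on_eq_continuous_within)+
    have contU: "continuous_on UNIV U"
      using U_deriv by (meson has_derivative_continuous continuous_at_imp_continuous_on)
    have "V (q b, p b, \<tau> b) \<le> V (q a, p a, \<tau> a)"
    proof (rule DERIV_nonpos_imp_decreasing_open[OF ab])
      show "continuous_on {a..b} (\<lambda>t. V (q t, p t, \<tau> t))"
        unfolding V_def prod.case
        by (intro continuous_intros cont continuous_on_compose2[OF contU]) auto
    next
      fix t assume "a < t" "t < b"
      then have t: "t \<in> {a<..<b}" "t \<in> {a..b}" by auto
      show "\<exists>y. ((\<lambda>t. V (q t, p t, \<tau> t)) has_real_derivative y) (at t) \<and> y \<le> 0"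
        using V_has_derivative[of q p t, OF q'[OF t(2), unfolded at[OF t(1)]]
            p'[OF t(2), unfolded at[OF t(1)]] \<tau>'[OF t(2), unfolded at[OF t(1)]]]
          Lie_derivative_nonpos[OF \<tau>C[OF t(2)]] by blast
    qed
    moreover have "\<tau> b - \<tau> a = \<eta> * (b - a)"
    proof -
      have "((\<lambda>_. \<eta>) has_integral \<tau> b - \<tau> a) {a..b}"
        using \<tau>' ab by (intro fundamental_theorem_of_calculus)
          (auto simp: has_real_derivative_iff_has_vector_derivative)
      then show ?thesis
        using has_integral_unique[OF _ has_integral_const_real[of \<eta> a b]] ab
        by (simp add: mult.commute)
    qed
    ultimately show ?thesis
      using fl(1)[of b] ab by (simp add: \<phi>)
  qed (use a in auto)
  then show "\<phi> b j \<in> flow_set sys" "V (\<phi> b j) \<le> V (\<phi> a j)"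
    "snd (snd (\<phi> b j)) = snd (snd (\<phi> a j)) + \<eta> * (b - a)" by auto
qed

text \<open>After a reset the first square is a multiple of \<open>(norm (q - s))\<^sup>2\<close>,
  and strong convexity turns it into \<open>4 * \<eta>\<^sup>2 / \<kappa> * U q\<close>. Together
  with \<open>T0\<^sup>2\<close> this gives \<open>U\<close> the weight \<open>T1\<close>, which is
  below \<open>T\<^sup>2\<close> by \<open>T_lower\<close>.\<close>

lemma V_jump: "\<exists>r>0. r < 1 \<and> (\<forall>q p. V (q, 0, T0) \<le> r * V (q, p, T))"
proof -
  define a where "a = 3 * \<eta> * (1 - \<eta>)"
  define T1 where "T1 = T0\<^sup>2 + 4 * \<eta>\<^sup>2 / \<kappa>"
  \<comment> \<open>The share \<open>1 - r\<close> of the summand that a jump leaves unchanged is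
    also bounded by \<open>U\<close>; this \<open>r\<close> makes the resulting coefficient of
    \<open>U\<close> equal to \<open>r * T\<^sup>2\<close>.\<close>
  define r where "r = (2 * a / \<kappa> + T1) / (2 * a / \<kappa> + T\<^sup>2)"
  have pos: "0 < a" "0 < T1" "T1 < T\<^sup>2"
    using \<eta> T0 \<kappa> T_lower by (auto simp: a_def T1_def add_pos_nonneg)
  then have den: "0 < 2 * a / \<kappa> + T1" "2 * a / \<kappa> + T1 < 2 * a / \<kappa> + T\<^sup>2"
    using \<kappa> by (auto intro: add_pos_pos)
  then have r: "0 < r" "r < 1" unfolding r_def by auto
  have r_eq: "r * (2 * a / \<kappa> + T\<^sup>2) = 2 * a / \<kappa> + T1"
    using den by (simp add: r_def)
  have "V (q, 0, T0) \<le> r * V (q, p, T)" for q p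
  proof -
    define E where "E = (norm (q - s))\<^sup>2"
    have E: "E \<le> 2 / \<kappa> * U q"
      using U_lower[of q] \<kappa> by (simp add: E_def field_simps)
    have "V (q, 0, T0) = 2 * \<eta>\<^sup>2 * E + a * E + T0\<^sup>2 * U q"
      by (simp add: V_def a_def E_def power_mult_distrib)
    also have "\<dots> \<le> 2 * \<eta>\<^sup>2 * (2 / \<kappa> * U q) + a * E + T0\<^sup>2 * U q"
      using E pos by (intro add_mono mult_left_mono) auto
    also have "\<dots> = r * (a * E) + (1 - r) * a * E + T1 * U q"
      by (simp add: T1_def algebra_simps)
    also have "\<dots> \<le> r * (a * E) + (1 - r) * a * (2 / \<kappa> * U q) + T1 * U q"
      using E r pos by (intro add_mono mult_left_mono mult_nonneg_nonneg order_refl) simp_all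
    also have "\<dots> = r * (a * E) + (2 * a / \<kappa> + T1 - r * (2 * a / \<kappa>)) * U q"
      by (simp add: algebra_simps diff_divide_distrib)
    also have "\<dots> = r * (a * E + T\<^sup>2 * U q)"
      unfolding r_eq[symmetric] by (simp add: algebra_simps diff_divide_distrib)
    also have "\<dots> \<le> r * V (q, p, T)"
      using r by (intro mult_left_mono) (auto simp: V_def a_def E_def)
    finally show ?thesis .
  qed
  then show ?thesis using r by blast
qed

section \<open>Comparison of the Lyapunov function with the distance to the attractor\<close>

text \<open>A clock value in \<open>{T0..T}\<close> is matched exactly by a point of
  \<open>A\<close>, so only the first two components count.\<close>

lemma infdist_A:
  assumes "\<tau> \<in> {T0..T}"
  shows "(infdist (q, p, \<tau>) A)\<^sup>2 = (norm (q - s))\<^sup>2 + (norm p)\<^sup>2"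
proof -
  have d: "(dist (q, p, \<tau>) (s, 0, \<tau>'))\<^sup>2 = (norm (q - s))\<^sup>2 + (norm p)\<^sup>2 + (\<tau> - \<tau>')\<^sup>2" for \<tau>'
    by (simp add: dist_norm norm_Pair)
  have "closed A" "A \<noteq> {}"
    using T0_less_T by (auto intro!: closed_Times)
  then obtain z where "z \<in> A" "infdist (q, p, \<tau>) A = dist (q, p, \<tau>) z"
    using infdist_attains_inf by blast
  then have "(norm (q - s))\<^sup>2 + (norm p)\<^sup>2 \<le> (infdist (q, p, \<tau>) A)\<^sup>2"
    using d by auto
  moreover have "infdist (q, p, \<tau>) A \<le> dist (q, p, \<tau>) (s, 0, \<tau>)"
    using assms by (intro infdist_le) auto
  then have "(infdist (q, p, \<tau>) A)\<^sup>2 \<le> (norm (q - s))\<^sup>2 + (norm p)\<^sup>2"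
    using d[of \<tau>] power_mono[of "infdist (q, p, \<tau>) A" "dist (q, p, \<tau>) (s, 0, \<tau>)" 2]
    by (simp add: infdist_nonneg)
  ultimately show ?thesis by simp
qed

lemma V_upper:
  obtains c where "c > 0" "\<And>z. z \<in> flow_set sys \<Longrightarrow> V z \<le> c * (infdist z A)\<^sup>2"
proof (rule that)
  \<comment> \<open>The crude bounds \<open>\<eta> \<le> 1\<close> and \<open>\<tau> \<le> T\<close>
    give 4 and 3 for the position terms, \<open>T\<^sup>2\<close> for the velocity and
    \<open>T\<^sup>2 * L\<^sub>F\<close> for the potential.\<close>
  show "7 + T\<^sup>2 + T\<^sup>2 * L\<^sub>F > 0"
    using L\<^sub>F by (simp add: add_pos_nonneg)
  fix z :: "'n state" assume "z \<in> flow_set sys"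
  then obtain q p \<tau> where z: "z = (q, p, \<tau>)" and \<tau>: "\<tau> \<in> {T0..T}"
    by (auto simp: flow_set_sys)
  define e where "e = q - s"
  have \<tau>2: "\<tau>\<^sup>2 \<le> T\<^sup>2" using \<tau> T0 by (intro power_mono) auto
  have "\<eta>\<^sup>2 \<le> 1" using \<eta> by (simp add: power_le_one)
  have "(norm ((2 * \<eta>) *\<^sub>R e + \<tau> *\<^sub>R p))\<^sup>2 \<le> (norm ((2 * \<eta>) *\<^sub>R e) + norm (\<tau> *\<^sub>R p))\<^sup>2"
    by (intro power_mono norm_triangle_ineq) auto
  also have "\<dots> \<le> 2 * ((norm ((2 * \<eta>) *\<^sub>R e))\<^sup>2 + (norm (\<tau> *\<^sub>R p))\<^sup>2)"
    using sum_squares_bound[of "norm ((2 * \<eta>) *\<^sub>R e)" "norm (\<tau> *\<^sub>R p)"] by (simp add: power2_sum)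
  also have "\<dots> = 8 * (\<eta>\<^sup>2 * (norm e)\<^sup>2) + 2 * (\<tau>\<^sup>2 * (norm p)\<^sup>2)"
    by (simp add: power_mult_distrib)
  also have "\<dots> \<le> 8 * (1 * (norm e)\<^sup>2) + 2 * (T\<^sup>2 * (norm p)\<^sup>2)"
    using \<tau>2 \<open>\<eta>\<^sup>2 \<le> 1\<close> by (intro add_mono mult_left_mono mult_right_mono) auto
  finally have 1: "(norm ((2 * \<eta>) *\<^sub>R e + \<tau> *\<^sub>R p))\<^sup>2 / 2 \<le> 4 * (norm e)\<^sup>2 + T\<^sup>2 * (norm p)\<^sup>2"
    by simp
  have 2: "3 * \<eta> * (1 - \<eta>) * (norm e)\<^sup>2 \<le> 3 * (norm e)\<^sup>2"
    using \<eta> mult_mono[of \<eta> 1 "1 - \<eta>" 1] by (intro mult_right_mono) auto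
  have "0 \<le> U q" using U_lower[of q] \<kappa>
    by (meson order_trans zero_le_mult_iff zero_le_power2 divide_nonneg_pos less_imp_le zero_less_numeral)
  then have 3: "\<tau>\<^sup>2 * U q \<le> T\<^sup>2 * (L\<^sub>F * (norm e)\<^sup>2)"
    using \<tau>2 U_upper[of q] unfolding e_def by (intro mult_mono) auto
  have "V z \<le> (4 * (norm e)\<^sup>2 + T\<^sup>2 * (norm p)\<^sup>2) + 3 * (norm e)\<^sup>2 + T\<^sup>2 * (L\<^sub>F * (norm e)\<^sup>2)"
    using 1 2 3 by (simp add: z V_def e_def)
  also have "\<dots> \<le> (7 + T\<^sup>2 + T\<^sup>2 * L\<^sub>F) * ((norm e)\<^sup>2 + (norm p)\<^sup>2)"
    using L\<^sub>F by (simp add: algebra_simps)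
  finally show "V z \<le> (7 + T\<^sup>2 + T\<^sup>2 * L\<^sub>F) * (infdist z A)\<^sup>2"
    using infdist_A[OF \<tau>, of q p] by (simp add: z e_def)
qed

text \<open>The first square of \<open>V\<close> controls \<open>w = 2 \<eta> e + \<tau> p\<close>
  and the potential controls \<open>e\<close>; since \<open>\<tau> \<ge> T0 > 0\<close>, the
  velocity is recovered from the two.\<close>

lemma V_lower:
  obtains c where "c > 0" "\<And>z. z \<in> flow_set sys \<Longrightarrow> c * (infdist z A)\<^sup>2 \<le> V z"
proof -
  define k where "k = T0\<^sup>2 * \<kappa> / 2"
  \<comment> \<open>The entries of the minimum keep the final coefficients of
    \<open>(norm w)\<^sup>2\<close> and \<open>(norm e)\<^sup>2\<close> at most \<open>1 / 2\<close>
    and \<open>k\<close>.\<close>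
  define c where "c = min (T0\<^sup>2 / 4) (k / (8 / T0\<^sup>2 + 1))"
  have "k > 0" using T0 \<kappa> by (simp add: k_def)
  have pos: "8 / T0\<^sup>2 + 1 > 0" by (simp add: add_nonneg_pos)
  have "c > 0" using T0 \<open>k > 0\<close> pos by (simp add: c_def)
  have c1: "c * (2 / T0\<^sup>2) \<le> 1 / 2"
  proof -
    have "c * (2 / T0\<^sup>2) \<le> T0\<^sup>2 / 4 * (2 / T0\<^sup>2)"
      unfolding c_def by (intro mult_right_mono min.cobounded1) auto
    then show ?thesis using T0 by simp
  qed
  have c2: "c * (8 / T0\<^sup>2 + 1) \<le> k"
    using pos by (simp add: c_def pos_le_divide_eq[symmetric])
  have "c * (infdist z A)\<^sup>2 \<le> V z" if C: "z \<in> flow_set sys" for z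
  proof -
    obtain q p \<tau> where z: "z = (q, p, \<tau>)" and \<tau>: "\<tau> \<in> {T0..T}"
      using C by (auto simp: flow_set_sys)
    define e where "e = q - s"
    define w where "w = (2 * \<eta>) *\<^sub>R e + \<tau> *\<^sub>R p"
    have \<tau>2: "T0\<^sup>2 \<le> \<tau>\<^sup>2" using \<tau> T0 by (intro power_mono) auto
    have "\<eta>\<^sup>2 \<le> 1" using \<eta> by (simp add: power_le_one)
    have "T0\<^sup>2 * (norm p)\<^sup>2 \<le> (norm (\<tau> *\<^sub>R p))\<^sup>2"
      using \<tau>2 by (simp add: power_mult_distrib mult_right_mono)
    also have "\<dots> = (norm (w - (2 * \<eta>) *\<^sub>R e))\<^sup>2" by (simp add: w_def)
    also have "\<dots> \<le> (norm w + norm ((2 * \<eta>) *\<^sub>R e))\<^sup>2"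
      by (intro power_mono norm_triangle_ineq4) auto
    also have "\<dots> \<le> 2 * ((norm w)\<^sup>2 + (norm ((2 * \<eta>) *\<^sub>R e))\<^sup>2)"
      using sum_squares_bound[of "norm w" "norm ((2 * \<eta>) *\<^sub>R e)"] by (simp add: power2_sum)
    also have "\<dots> = 2 * (norm w)\<^sup>2 + 8 * (\<eta>\<^sup>2 * (norm e)\<^sup>2)"
      by (simp add: power_mult_distrib)
    also have "\<dots> \<le> 2 * (norm w)\<^sup>2 + 8 * (1 * (norm e)\<^sup>2)"
      using \<open>\<eta>\<^sup>2 \<le> 1\<close> by (intro add_mono mult_left_mono mult_right_mono) auto
    finally have "(norm p)\<^sup>2 \<le> (2 * (norm w)\<^sup>2 + 8 * (norm e)\<^sup>2) / T0\<^sup>2"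
      using T0 by (simp add: field_simps)
    then have "c * ((norm e)\<^sup>2 + (norm p)\<^sup>2)
        \<le> c * ((norm e)\<^sup>2 + (2 * (norm w)\<^sup>2 + 8 * (norm e)\<^sup>2) / T0\<^sup>2)"
      using \<open>c > 0\<close> by simp
    also have "\<dots> = c * (2 / T0\<^sup>2) * (norm w)\<^sup>2 + c * (8 / T0\<^sup>2 + 1) * (norm e)\<^sup>2"
      by (simp add: algebra_simps add_divide_distrib)
    also have "\<dots> \<le> 1 / 2 * (norm w)\<^sup>2 + k * (norm e)\<^sup>2"
      using c1 c2 by (intro add_mono mult_right_mono) auto
    also have "k * (norm e)\<^sup>2 \<le> \<tau>\<^sup>2 * U q"
    proof -
      have "T0\<^sup>2 * (\<kappa> / 2 * (norm e)\<^sup>2) \<le> \<tau>\<^sup>2 * U q"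
        using \<tau>2 U_lower[of q] \<kappa> unfolding e_def by (intro mult_mono) auto
      then show ?thesis by (simp add: k_def)
    qed
    finally have "c * ((norm e)\<^sup>2 + (norm p)\<^sup>2) \<le> 1 / 2 * (norm w)\<^sup>2 + \<tau>\<^sup>2 * U q" by simp
    also have "\<dots> \<le> V z"
      using \<eta> by (simp add: z V_def w_def e_def)
    finally show ?thesis
      using infdist_A[OF \<tau>, of q p] by (simp add: z e_def)
  qed
  then show ?thesis using that \<open>c > 0\<close> by blast
qed

section \<open>Exponential decay along solutions\<close>

text \<open>The third invariant measures time by the clock: a full sweep from \<open>T0\<close> to
  \<open>T\<close> takes \<open>(T - T0) / \<eta>\<close>, and a jump trades the drop of the clock
  for one more unit of \<open>j\<close>. It is an inequality because the clock may start above
  \<open>T0\<close>.\<close>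

lemma solution_bounds:
  assumes sol: "hybrid_solution sys E \<phi>" and tj: "(t, j) \<in> E"
    and r: "0 \<le> r" "\<And>q p. V (q, 0, T0) \<le> r * V (q, p, T)"
  shows "\<phi> t j \<in> flow_set sys \<and> V (\<phi> t j) \<le> r ^ j * V (\<phi> 0 0) \<and>
    \<eta> * t \<le> real j * (T - T0) + (snd (snd (\<phi> t j)) - T0)"
proof -
  have "hybrid_time_domain E" using sol by (simp add: hybrid_solution_def hybrid_arc_def)
  from this tj show ?thesis
  proof (induction rule: hybrid_time_domain_induct)
    case start
    have "\<phi> 0 0 \<in> closure (flow_set sys) \<union> jump_set sys"
      using sol by (simp add: hybrid_solution_def)
    then have "\<phi> 0 0 \<in> flow_set sys"
      using closure_closed[OF closed_flow_set_sys] T0_less_T by (auto simp: flow_set_sys jump_set_sys)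
    then show ?case by (auto simp: flow_set_sys)
  next
    case (flow a b j)
    then have a: "\<phi> a j \<in> flow_set sys" by blast
    note step = flow_step[OF sol flow(1,2) a]
    show ?case
      using step flow(3) by (auto simp: algebra_simps)
  next
    case (jump t j)
    then have J: "\<phi> t j \<in> jump_set sys" "\<phi> t (Suc j) = jump_map sys (\<phi> t j)"
      using sol unfolding hybrid_solution_def by blast+
    then obtain q p where qp: "\<phi> t j = (q, p, T)" "\<phi> t (Suc j) = (q, 0, T0)"
      by (auto simp: jump_set_sys jump_map_sys)
    have "V (q, 0, T0) \<le> r * V (q, p, T)" by (rule r)
    also have "\<dots> \<le> r * (r ^ j * V (\<phi> 0 0))"
      using jump(3) r(1) by (intro mult_left_mono) (auto simp: qp)
    finally show ?case
      using jump(3) T0_less_T by (simp add: qp flow_set_sys algebra_simps)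
  qed
qed

text \<open>The decay of \<open>V\<close> per jump becomes decay in \<open>t + j\<close> because the
  time between jumps is bounded, and \<open>V\<close> is comparable with the squared distance to
  \<open>A\<close>.\<close>

theorem UGES_sys: "UGES sys A"
proof -
  obtain r where r: "0 < r" "r < 1" "\<And>q p. V (q, 0, T0) \<le> r * V (q, p, T)"
    using V_jump by blast
  obtain cU where cU: "cU > 0" "\<And>z. z \<in> flow_set sys \<Longrightarrow> V z \<le> cU * (infdist z A)\<^sup>2"
    using V_upper by blast
  obtain cL where cL: "cL > 0" "\<And>z. z \<in> flow_set sys \<Longrightarrow> cL * (infdist z A)\<^sup>2 \<le> V z"
    using V_lower by blast
  \<comment> \<open>\<open>D\<close> is the longest time between jumps, so that
    \<open>t + j \<le> j * (D + 1) + D\<close>. The 2 in \<open>c2\<close> accounts for the squared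
    distance, and \<open>exp (c2 * D)\<close> in \<open>c1\<close> pays for the last summand
    \<open>D\<close>.\<close>
  define D where "D = (T - T0) / \<eta>"
  define c2 where "c2 = - ln r / (2 * (D + 1))"
  define c1 where "c1 = sqrt (cU / cL) * exp (c2 * D)"
  have "D > 0" using T0_less_T \<eta> by (simp add: D_def)
  then have "c2 > 0" using r by (simp add: c2_def divide_neg_pos)
  have "c1 > 0" using cU cL by (simp add: c1_def)
  have "infdist (\<phi> t j) A \<le> c1 * infdist (\<phi> 0 0) A * exp (- c2 * (t + real j))"
    if sol: "hybrid_solution sys E \<phi>" and tj: "(t, j) \<in> E" for E \<phi> t j
  proof (rule power2_le_imp_le)
    have b: "\<phi> t j \<in> flow_set sys" "V (\<phi> t j) \<le> r ^ j * V (\<phi> 0 0)"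
      "\<eta> * t \<le> real j * (T - T0) + (snd (snd (\<phi> t j)) - T0)"
      using solution_bounds[OF sol tj _ r(3)] r(1) by auto
    have "(0, 0) \<in> E" using sol by (simp add: hybrid_solution_def)
    then have C0: "\<phi> 0 0 \<in> flow_set sys"
      using solution_bounds[OF sol _ _ r(3)] r(1) by auto
    have "\<eta> * t \<le> real j * (T - T0) + (T - T0)"
      using b(1,3) by (auto simp: flow_set_sys)
    also have "\<dots> = \<eta> * (real j * D + D)"
      using \<eta> by (simp add: D_def distrib_left)
    finally have "t \<le> real j * D + D"
      using \<eta> by simp
    then have "t + real j - D \<le> real j * (D + 1)" by (simp add: algebra_simps)
    then have "2 * c2 * (t + real j - D) \<le> 2 * c2 * (real j * (D + 1))"
      using \<open>c2 > 0\<close> by simp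
    also have "\<dots> = - (real j * ln r)"
      using \<open>D > 0\<close> by (simp add: c2_def field_simps)
    finally have le: "real j * ln r \<le> 2 * (c2 * D - c2 * (t + real j))"
      by (simp add: algebra_simps)
    have "r ^ j = exp (real j * ln r)"
      using r(1) by (simp add: exp_of_nat_mult)
    also have "\<dots> \<le> exp (2 * (c2 * D - c2 * (t + real j)))"
      using le by simp
    also have "\<dots> = (exp (c2 * D) * exp (- c2 * (t + real j)))\<^sup>2"
      by (simp add: exp_double exp_diff exp_minus divide_inverse power_mult_distrib power_inverse)
    finally have rj: "r ^ j \<le> (exp (c2 * D) * exp (- c2 * (t + real j)))\<^sup>2" .
    have "cL * (infdist (\<phi> t j) A)\<^sup>2 \<le> r ^ j * V (\<phi> 0 0)"
      using cL(2)[OF b(1)] b(2) by linarith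
    also have "\<dots> \<le> (exp (c2 * D) * exp (- c2 * (t + real j)))\<^sup>2 * (cU * (infdist (\<phi> 0 0) A)\<^sup>2)"
      using rj r(1) cL(2)[OF C0] cL(1) cU(2)[OF C0]
      by (intro mult_mono) (auto intro: order_trans[rotated])
    finally have "(infdist (\<phi> t j) A)\<^sup>2 \<le>
        cU / cL * ((exp (c2 * D) * exp (- c2 * (t + real j)))\<^sup>2 * (infdist (\<phi> 0 0) A)\<^sup>2)"
      using cL(1) by (simp add: field_simps)
    also have "\<dots> = (c1 * infdist (\<phi> 0 0) A * exp (- c2 * (t + real j)))\<^sup>2"
      using cU(1) cL(1) by (simp add: c1_def power_mult_distrib)
    finally show "(infdist (\<phi> t j) A)\<^sup>2 \<le> (c1 * infdist (\<phi> 0 0) A * exp (- c2 * (t + real j)))\<^sup>2" .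
  qed (use \<open>c1 > 0\<close> in \<open>simp add: infdist_nonneg\<close>)
  moreover have "compact A" by (intro compact_Times) auto
  ultimately show ?thesis
    unfolding UGES_def using \<open>c1 > 0\<close> \<open>c2 > 0\<close> by blast
qed

end

section \<open>From the Helmholtz decomposition to stability and the estimates on \<open>J\<close>
  and \<open>\<G>\<close>\<close>

theorem theorem5p1:
  fixes \<G> :: "real^'n::finite \<Rightarrow> real^'n"
    and P K :: "real^'n \<Rightarrow> real^'n^'n"
    and J :: "real^'n \<Rightarrow> real"
    and kappa_J ell_J ell_K T0 T \<eta> T_lower T_upper :: real
  assumes analytic: "real_analytic_on \<G> UNIV"
    and helmholtz: "helmholtz_decomposition \<G> P J K"
    and kappa_J_pos: "kappa_J > 0"
    and grad_strongly_monotone: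
      "\<forall>x1 x2. (grad J x1 - grad J x2) \<bullet> (x1 - x2) \<ge> kappa_J * (norm (x1 - x2))\<^sup>2"
    and rot_monotone: "\<forall>x1 x2. (rot K x1 - rot K x2) \<bullet> (x1 - x2) \<ge> 0"
    and ell_J_pos: "ell_J > 0"
    and ell_K_pos: "ell_K > 0"
    and grad_Lipschitz: "\<forall>x1 x2. norm (grad J x1 - grad J x2) \<le> ell_J * norm (x1 - x2)"
    and rot_Lipschitz: "\<forall>x1 x2. norm (rot K x1 - rot K x2) \<le> ell_K * norm (x1 - x2)"
    and T0: "0 < T0" "T0 < T"
    and \<eta>: "\<eta> \<in> {0<..<1}"
    and T_lower: "T_lower\<^sup>2 = T0\<^sup>2 + 4 * \<eta>\<^sup>2 / kappa_J" "T_lower > 0"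
    and T_upper: "T_upper = 2 * min (3 * (1 - \<eta>)) (kappa_J * \<eta>) / ell_K"
    and T: "T_lower < T" "T \<le> T_upper"
  shows "(\<exists>!x. \<G> x = 0) \<and>
    (\<forall>xstar. \<G> xstar = 0 \<longrightarrow>
      UGES (restarting_system \<G> \<eta> T0 T) ({xstar} \<times> {0} \<times> {T0..T}) \<and>
      (\<exists>\<rho>>0. \<forall>K0. compact K0 \<and>
           K0 \<subseteq> flow_set (restarting_system \<G> \<eta> T0 T) \<union> jump_set (restarting_system \<G> \<eta> T0 T) \<longrightarrow>
         (\<exists>M_J>0. \<exists>M_G>0. \<forall>E \<phi>.
            hybrid_solution (restarting_system \<G> \<eta> T0 T) E \<phi> \<and> \<phi> 0 0 \<in> K0 \<longrightarrow>
            (\<forall>(t, j)\<in>E. case \<phi> t j of (q, p, \<tau>) \<Rightarrow>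
               J q - J xstar \<le> M_J * T\<^sup>2 * exp (- \<rho> * real j) / \<tau>\<^sup>2 \<and>
               (norm (\<G> q))\<^sup>2 \<le> M_G * T\<^sup>2 * exp (- \<rho> * real j) / \<tau>\<^sup>2))))"
proof -
  have G_eq: "\<G> x = grad J x + rot K x" for x
    using helmholtz by (simp add: helmholtz_decomposition_def)
  have J_deriv: "(J has_derivative (\<lambda>h. grad J x \<bullet> h)) (at x)" for x
    using helmholtz by (intro grad_has_derivative)
      (simp add: helmholtz_decomposition_def differentiable_on_def)
  have G_lip: "norm (\<G> x - \<G> y) \<le> (ell_J + ell_K) * norm (x - y)" for x y
  proof -
    have "\<G> x - \<G> y = (grad J x - grad J y) + (rot K x - rot K y)" by (simp add: G_eq)
    then have "norm (\<G> x - \<G> y) \<le> norm (grad J x - grad J y) + norm (rot K x - rot K y)"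
      by (metis norm_triangle_ineq)
    also have "\<dots> \<le> ell_J * norm (x - y) + ell_K * norm (x - y)"
      using grad_Lipschitz rot_Lipschitz by (intro add_mono) auto
    finally show ?thesis by (simp add: distrib_right)
  qed
  have G_mono: "(\<G> x - \<G> y) \<bullet> (x - y) \<ge> kappa_J * (norm (x - y))\<^sup>2" for x y
  proof -
    have "(\<G> x - \<G> y) \<bullet> (x - y) = (grad J x - grad J y) \<bullet> (x - y) + (rot K x - rot K y) \<bullet> (x - y)"
      by (simp add: G_eq inner_add_left inner_diff_left)
    moreover have "(grad J x - grad J y) \<bullet> (x - y) \<ge> kappa_J * (norm (x - y))\<^sup>2"
      "(rot K x - rot K y) \<bullet> (x - y) \<ge> 0"
      using grad_strongly_monotone rot_monotone by auto
    ultimately show ?thesis by linarith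
  qed
  have J_lower: "J y \<ge> J x + grad J x \<bullet> (y - x) + kappa_J / 2 * (norm (y - x))\<^sup>2" for x y
    using J_deriv grad_strongly_monotone by (intro strongly_convex_lower_bound) auto
  have ex1: "\<exists>!x. \<G> x = 0"
    using strongly_monotone_Lipschitz_ex1_zero[OF kappa_J_pos _ G_mono G_lip] ell_J_pos ell_K_pos by simp
  moreover have "UGES (restarting_system \<G> \<eta> T0 T) ({s} \<times> {0} \<times> {T0..T}) \<and>
      (\<exists>\<rho>>0. \<forall>K0. compact K0 \<and>
           K0 \<subseteq> flow_set (restarting_system \<G> \<eta> T0 T) \<union> jump_set (restarting_system \<G> \<eta> T0 T) \<longrightarrow>
         (\<exists>M_J>0. \<exists>M_G>0. \<forall>E \<phi>.
            hybrid_solution (restarting_system \<G> \<eta> T0 T) E \<phi> \<and> \<phi> 0 0 \<in> K0 \<longrightarrow>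
            (\<forall>(t, j)\<in>E. case \<phi> t j of (q, p, \<tau>) \<Rightarrow>
               J q - J s \<le> M_J * T\<^sup>2 * exp (- \<rho> * real j) / \<tau>\<^sup>2 \<and>
               (norm (\<G> q))\<^sup>2 \<le> M_G * T\<^sup>2 * exp (- \<rho> * real j) / \<tau>\<^sup>2)))"
    if s: "\<G> s = 0" for s
  proof -
    define U where "U x = J x - J s - grad J s \<bullet> (x - s)" for x
    define F where "F x = grad J x - grad J s" for x
    define R where "R x = rot K x - rot K s" for x
    \<comment> \<open>The strong convexity bound is used with base point \<open>x\<close> and
      evaluated at \<open>s\<close>; with base point \<open>s\<close> it later gives the lower bound
      on \<open>U\<close>.\<close>
    have F_inner: "U x + kappa_J / 2 * (norm (x - s))\<^sup>2 \<le> F x \<bullet> (x - s)" for x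
      using J_lower[of x s]
      by (simp add: U_def F_def norm_minus_commute inner_diff_left inner_diff_right algebra_simps)
    have U_upper: "U x \<le> ell_J * (norm (x - s))\<^sup>2" for x
    proof -
      have "U x \<le> F x \<bullet> (x - s)" using F_inner[of x] kappa_J_pos
        by (smt (verit) divide_pos_pos mult_nonneg_nonneg zero_le_power2)
      also have "\<dots> \<le> norm (F x) * norm (x - s)" by (rule norm_cauchy_schwarz)
      also have "\<dots> \<le> ell_J * norm (x - s) * norm (x - s)"
        using grad_Lipschitz unfolding F_def by (intro mult_right_mono) auto
      finally show ?thesis by (simp add: power2_eq_square)
    qed
    have T_min: "T * ell_K \<le> 2 * min (3 * (1 - \<eta>)) (kappa_J * \<eta>)"
      using T(2) ell_K_pos by (simp add: T_upper pos_le_divide_eq)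
    interpret restarting_split \<G> F R U s kappa_J ell_J ell_K T0 T \<eta>
    proof
      \<comment> \<open>The shifts cancel in the sum because
        \<open>grad J s + rot K s = 0\<close>.\<close>
      show "\<G> x = F x + R x" for x
        using s G_eq[of s] by (simp add: G_eq F_def R_def algebra_simps)
      have "(ell_J + ell_K)-lipschitz_on UNIV \<G>"
        using G_lip ell_J_pos ell_K_pos by (intro lipschitz_onI) (auto simp: dist_norm)
      then show "continuous_on UNIV \<G>" by (rule lipschitz_on_continuous_on)
      show "(U has_derivative (\<lambda>h. F x \<bullet> h)) (at x)" for x
        unfolding U_def[abs_def] F_def
        by (rule derivative_eq_intros J_deriv refl)+ (simp add: fun_eq_iff inner_diff_left)
      show "kappa_J / 2 * (norm (x - s))\<^sup>2 \<le> U x" for x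
        using J_lower[of s x] by (simp add: U_def)
      show "0 \<le> R x \<bullet> (x - s)" "norm (R x) \<le> ell_K * norm (x - s)" for x
        using rot_monotone rot_Lipschitz by (auto simp: R_def)
      have "T_lower\<^sup>2 < T\<^sup>2" using T T_lower(2) by (intro power_strict_mono) auto
      then show "T0\<^sup>2 + 4 * \<eta>\<^sup>2 / kappa_J < T\<^sup>2" using T_lower(1) by simp
      show "T * ell_K \<le> 2 * (3 * (1 - \<eta>))" "T * ell_K \<le> 2 * (kappa_J * \<eta>)"
        using T_min min.cobounded1[of "3 * (1 - \<eta>)" "kappa_J * \<eta>"]
          min.cobounded2[of "3 * (1 - \<eta>)" "kappa_J * \<eta>"] by linarith+
    qed (use kappa_J_pos ell_J_pos ell_K_pos T0 \<eta> U_upper F_inner in auto)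
    \<comment> \<open>The rate \<open>c2\<close> serves as \<open>\<rho>\<close>: it comes from
      stability alone, hence does not depend on \<open>K0\<close>.\<close>
    obtain c1 c2 where c: "c1 > 0" "c2 > 0" and decay: "\<And>E \<phi> t j. hybrid_solution sys E \<phi> \<Longrightarrow> (t, j) \<in> E \<Longrightarrow>
        infdist (\<phi> t j) A \<le> c1 * infdist (\<phi> 0 0) A * exp (- c2 * (t + real j))"
      using UGES_sys unfolding UGES_def by blast
    have "\<exists>M_J>0. \<exists>M_G>0. \<forall>E \<phi>. hybrid_solution sys E \<phi> \<and> \<phi> 0 0 \<in> K0 \<longrightarrow>
            (\<forall>(t, j)\<in>E. case \<phi> t j of (q, p, \<tau>) \<Rightarrow>
               J q - J s \<le> M_J * T\<^sup>2 * exp (- c2 * real j) / \<tau>\<^sup>2 \<and>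
               (norm (\<G> q))\<^sup>2 \<le> M_G * T\<^sup>2 * exp (- c2 * real j) / \<tau>\<^sup>2)"
      if K0: "compact K0" for K0
    proof -
      have "bounded ((\<lambda>z. infdist z A) ` K0)"
        using K0 by (intro compact_imp_bounded compact_continuous_image continuous_intros)
      then obtain B where "B > 0" and B: "\<And>z. z \<in> K0 \<Longrightarrow> infdist z A \<le> B"
        unfolding bounded_pos by fastforce
      define m where "m = c1 * B"
      have "m > 0" using c \<open>B > 0\<close> by (simp add: m_def)
      \<comment> \<open>The first summand accounts for the linear term
        \<open>grad J s \<bullet> (q - s)\<close>, the second for \<open>U q\<close>.\<close>
      define M_J where "M_J = norm (grad J s) * m + ell_J * m\<^sup>2"
      define M_G where "M_G = (ell_J + ell_K)\<^sup>2 * m\<^sup>2"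
      have M: "M_J > 0" "M_G > 0"
        using \<open>m > 0\<close> ell_J_pos ell_K_pos by (auto simp: M_J_def M_G_def add_nonneg_pos)
      have "J q - J s \<le> M_J * T\<^sup>2 * exp (- c2 * real j) / \<tau>\<^sup>2 \<and>
          (norm (\<G> q))\<^sup>2 \<le> M_G * T\<^sup>2 * exp (- c2 * real j) / \<tau>\<^sup>2"
        if sol: "hybrid_solution sys E \<phi>" "\<phi> 0 0 \<in> K0" and tj: "(t, j) \<in> E"
          and \<phi>: "\<phi> t j = (q, p, \<tau>)" for E \<phi> t j q p \<tau>
      proof -
        obtain r where "0 < r" "r < 1" "\<And>q p. V (q, 0, T0) \<le> r * V (q, p, T)"
          using V_jump by blast
        then have "\<phi> t j \<in> flow_set sys"
          using solution_bounds[OF sol(1) tj, of r] by simp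
        then have \<tau>: "\<tau> \<in> {T0..T}" by (simp add: \<phi> flow_set_sys)
        have "hybrid_time_domain E"
          using sol(1) unfolding hybrid_solution_def hybrid_arc_def by blast
        then have "t \<ge> 0"
          using tj unfolding hybrid_time_domain_def by blast
        define x where "x = exp (- c2 * real j)"
        have x: "0 < x" "x \<le> 1" using c by (auto simp: x_def)
        have "(norm (q - s))\<^sup>2 \<le> (infdist (\<phi> t j) A)\<^sup>2"
          using infdist_A[OF \<tau>, of q p] by (simp add: \<phi>)
        then have "norm (q - s) \<le> infdist (\<phi> t j) A"
          using infdist_nonneg power2_le_imp_le by blast
        also have "\<dots> \<le> c1 * infdist (\<phi> 0 0) A * exp (- c2 * (t + real j))"
          by (rule decay[OF sol(1) tj])
        \<comment> \<open>The factor \<open>exp (- c2 * t)\<close> is at most 1 and is dropped, so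
          only the decay in \<open>j\<close> remains.\<close>
        also have "\<dots> \<le> c1 * B * x"
          unfolding x_def using B[OF sol(2)] c \<open>B > 0\<close> \<open>t \<ge> 0\<close> infdist_nonneg
          by (intro mult_mono) auto
        finally have q: "norm (q - s) \<le> m * x" by (simp add: m_def)
        \<comment> \<open>Squares decay at rate \<open>2 * c2\<close>, the linear term of
          \<open>J q - J s\<close> only at rate \<open>c2\<close>; \<open>x \<le> 1\<close> reduces
          all terms to the common rate \<open>c2\<close>.\<close>
        have "(m * x)\<^sup>2 \<le> m\<^sup>2 * x"
          using x power_decreasing[of 1 2 x] by (simp add: power_mult_distrib mult_left_mono)
        then have q2: "(norm (q - s))\<^sup>2 \<le> m\<^sup>2 * x"
          using q power_mono[OF q, of 2] by simp
        \<comment> \<open>Since \<open>\<tau> \<le> T\<close>, the factor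
          \<open>T\<^sup>2 / \<tau>\<^sup>2\<close> is at least 1 and may be inserted into any upper
          bound of this form.\<close>
        have "\<tau>\<^sup>2 \<le> T\<^sup>2" "0 < \<tau>\<^sup>2" using \<tau> T0 by (auto intro!: power_mono)
        then have scale: "y \<le> M * T\<^sup>2 * x / \<tau>\<^sup>2" if "y \<le> M * x" "M > 0" for y M
        proof -
          have "M * x * \<tau>\<^sup>2 \<le> M * x * T\<^sup>2"
            using that x \<open>\<tau>\<^sup>2 \<le> T\<^sup>2\<close> by (intro mult_left_mono) auto
          then have "M * x \<le> M * x * T\<^sup>2 / \<tau>\<^sup>2"
            using \<open>0 < \<tau>\<^sup>2\<close> by (simp add: pos_le_divide_eq)
          then show ?thesis using that by (simp add: mult_ac)
        qed
        have "J q - J s = U q + grad J s \<bullet> (q - s)" by (simp add: U_def)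
        also have "\<dots> \<le> ell_J * (norm (q - s))\<^sup>2 + norm (grad J s) * norm (q - s)"
          by (intro add_mono U_upper norm_cauchy_schwarz)
        also have "\<dots> \<le> ell_J * (m\<^sup>2 * x) + norm (grad J s) * (m * x)"
          using q q2 ell_J_pos by (intro add_mono mult_left_mono) auto
        finally have 1: "J q - J s \<le> M_J * x" by (simp add: M_J_def algebra_simps)
        have "(norm (\<G> q))\<^sup>2 \<le> ((ell_J + ell_K) * norm (q - s))\<^sup>2"
          using G_lip[of q s] s by (intro power_mono) auto
        also have "\<dots> \<le> (ell_J + ell_K)\<^sup>2 * (m\<^sup>2 * x)"
          unfolding power_mult_distrib using q2 by (intro mult_left_mono) auto
        finally have 2: "(norm (\<G> q))\<^sup>2 \<le> M_G * x" by (simp add: M_G_def)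
        show ?thesis
          using scale[OF 1 M(1)] scale[OF 2 M(2)] by (simp add: x_def)
      qed
      then show ?thesis using M by (intro exI[of _ M_J] exI[of _ M_G]) auto
    qed
    then show ?thesis using UGES_sys c(2) by blast
  qed
  ultimately show ?thesis by blast
qed

end
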